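(* Let $(P_n)_{n\ge 1}$ be an ultraflat sequence of polynomials $P_n \in \mathcal{K}_n$ and let $q \in (0,\infty)$. Then $$\frac{1}{2\pi} \int_0^{2\pi}\left| (P_n - P_n^* )(e^{it}) \right|^q \, dt \;\sim\; \frac{2^q\, \Gamma\left(\frac{q+1}{2}\right)}{\Gamma\left(\frac q2 + 1\right)\sqrt{\pi}}\; n^{q/2}\,.$$
   Context: For $n \ge 1$, $\mathcal{K}_n$ is the set of polynomials $p(z)=\sum_{k=0}^n a_k z^k$ with $a_k\in\mathbb{C}$ and $|a_k|=1$ for all $k=0,\dots,n$. A sequence $(P_n)_{n\ge1}$ with $P_n\in\mathcal{K}_n$ is called ultraflat if there is a sequence $(\varepsilon_n)$ of positive numbers tending to $0$ such that $(1-\varepsilon_n)\sqrt{n+1}\le |P_n(e^{it})|\le (1+\varepsilon_n)\sqrt{n+1}$ for all $t\in\mathbb{R}$ and all $n$. For $P(z)=\sum_{k=0}^n a_k z^k$ of degree $n$, the conjugate reciprocal polynomial is $P^*(z):=\sum_{k=0}^n \overline{a}_{n-k}z^k$. $\Gamma$ is the usual gamma function. The symbol $\sim$ means that the ratio of the left and right hand sides converges to $1$ as $n\to\infty$. *)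

theory Defs
  imports "HOL-Analysis.Analysis" "HOL-Computational_Algebra.Polynomial" "HOL-Library.Landau_Symbols"
begin

definition unimodular_polys :: "nat \<Rightarrow> complex poly set" where
  "unimodular_polys n = {\<Sum>k\<le>n. monom (a k) k | a. \<forall>k\<le>n. cmod (a k) = 1}"

text \<open>Sequences are indexed by \<open>n \<ge> 1\<close>; the value at \<open>0\<close> is unconstrained.\<close>

definition ultraflat :: "(nat \<Rightarrow> complex poly) \<Rightarrow> bool" where
  "ultraflat P \<longleftrightarrow> (\<forall>n\<ge>1. P n \<in> unimodular_polys n) \<and>
     (\<exists>\<epsilon> :: nat \<Rightarrow> real. (\<forall>n\<ge>1. \<epsilon> n > 0) \<and> \<epsilon> \<longlonglongrightarrow> 0 \<and>
        (\<forall>n\<ge>1. \<forall>t::real. (1 - \<epsilon> n) * sqrt (real n + 1) \<le> cmod (poly (P n) (cis t)) \<and>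
                         cmod (poly (P n) (cis t)) \<le> (1 + \<epsilon> n) * sqrt (real n + 1)))"

definition conj_reciprocal :: "complex poly \<Rightarrow> complex poly" where
  "conj_reciprocal p = (\<Sum>k\<le>degree p. monom (cnj (coeff p (degree p - k))) k)"

end

theory Submission
  imports Defs "HOL-Complex_Analysis.Complex_Analysis" "HOL-Real_Asymp.Real_Asymp"
begin

text \<open>
  Write \<open>p = P\<^sub>n / \<surd>(n + 1)\<close> and \<open>v = p\<^sup>2 e\<^bsup>-int\<^esup> / |p|\<^sup>2\<close> on the circle. There
  \<open>|P\<^sub>n - P\<^sub>n\<^sup>*|\<^sup>2 = |P\<^sub>n|\<^sup>2 (2 - 2 Re v)\<close>, so it suffices that \<open>v\<close> becomes equidistributed on the
  unit circle, that is, that the means of \<open>v\<^sup>k\<close>, \<open>k \<ge> 1\<close>, tend to \<open>0\<close>; the constant is then a Beta integral.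

  Flatness makes \<open>p p\<^sup>* - z\<^sup>n\<close> small, so \<open>p\<close> has no zeros in an annulus of width \<open>K / n\<close> with \<open>K\<close> large.
  A bound of the logarithm of \<open>p\<close> by Borel-Caratheodory then shows that on arcs of length \<open>C / n\<close> the function
  \<open>x \<mapsto> p (e\<^bsup>i(t + x)\<^esup>)\<close> is nearly an exponential, whence
  \<open>p (e\<^bsup>i(t + x)\<^esup>)\<^sup>m \<approx> p (e\<^bsup>it\<^esup>)\<^bsup>m - 1\<^esup> p (e\<^bsup>i(t + mx)\<^esup>)\<close>. Averaging the moment over the shifts
  \<open>x = 2 \<pi> j / (m (n + 1))\<close>, \<open>j < N\<close>, as in van der Corput's inequality, turns the \<open>m\<close>-th powers into
  the translates \<open>p (e\<^bsup>i(t + 2 \<pi> j / (n + 1))\<^esup>)\<close>, which are exactly orthonormal because all coefficients of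
  \<open>p\<close> have the same modulus. The moment is therefore \<open>O(N\<^bsup>-1/2\<^esup>) + o(1)\<close> for every \<open>N\<close>.
\<close>

section \<open>Flat polynomials are locally exponential\<close>

text \<open>The Moebius map \<open>w / (2 * A - w)\<close> sends the half-plane
  \<open>Re w < A\<close> into the unit disc and fixes 0, so the Schwarz lemma applies to its
  composition with \<open>f\<close>. Solving the resulting inequality for \<open>cmod (f z)\<close>
  gives the bound.\<close>

lemma Borel_Caratheodory:
  assumes holf: "f holomorphic_on ball 0 r" and f0: "f 0 = 0"
    and re: "\<And>z. z \<in> ball 0 r \<Longrightarrow> Re (f z) < A" and z: "z \<in> ball 0 r"
  shows "cmod (f z) \<le> 2 * A * cmod z / (r - cmod z)"
proof -
  have r: "r > 0" and zr: "cmod z < r"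
    using z by (auto intro: le_less_trans[OF norm_ge_zero])
  have A: "A > 0"
    using re[of 0] r f0 by simp
  have strict: "cmod (f w) < cmod (2 * A - f w)" if "w \<in> ball 0 r" for w
  proof -
    have "(cmod (2 * A - f w))\<^sup>2 - (cmod (f w))\<^sup>2 = 4 * A * (A - Re (f w))"
      unfolding cmod_power2 by (simp add: power2_eq_square algebra_simps)
    also have "\<dots> > 0"
      using re[OF that] A by simp
    finally show ?thesis
      by (simp add: power2_less_imp_less)
  qed
  define \<phi> where "\<phi> w = f (r * w) / (2 * A - f (r * w))" for w :: complex
  have in_ball: "of_real r * w \<in> ball 0 r" if "cmod w < 1" for w
    using that r by (simp add: norm_mult)
  have "\<phi> holomorphic_on ball 0 1"
  proof -
    have "(f \<circ> (\<lambda>w. of_real r * w)) holomorphic_on ball 0 1"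
      by (intro holomorphic_on_compose_gen[OF _ holf] holomorphic_intros) (use in_ball in auto)
    moreover have "2 * A - f (r * w) \<noteq> 0" if "w \<in> ball 0 1" for w :: complex
      using strict[OF in_ball, of w] that by fastforce
    ultimately show ?thesis
      unfolding \<phi>_def by (auto intro!: holomorphic_intros simp: o_def)
  qed
  moreover have "\<phi> 0 = 0"
    by (simp add: \<phi>_def f0)
  moreover have "cmod (\<phi> w) < 1" if "cmod w < 1" for w
  proof -
    have "cmod (f (r * w)) < cmod (2 * A - f (r * w))"
      by (rule strict[OF in_ball[OF that]])
    then show ?thesis
      using le_less_trans[OF norm_ge_zero] unfolding \<phi>_def norm_divide
      by (subst divide_less_eq_1_pos) blast+
  qed
  ultimately have "cmod (\<phi> (z / r)) \<le> cmod (z / r)"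
    by (rule Schwarz_Lemma(1)) (use zr r in \<open>simp_all add: norm_divide\<close>)
  then have "cmod (f z) / cmod (2 * A - f z) \<le> cmod z / r"
    using r by (simp add: \<phi>_def norm_divide)
  moreover have "cmod (2 * A - f z) > 0"
    using strict[OF z] le_less_trans[OF norm_ge_zero] by blast
  ultimately have "r * cmod (f z) \<le> cmod z * cmod (2 * A - f z)"
    using r by (simp add: field_simps)
  also have "\<dots> \<le> cmod z * (2 * A + cmod (f z))"
    using norm_triangle_ineq4[of "complex_of_real (2 * A)" "f z"] A
    by (intro mult_left_mono) (auto simp: norm_mult)
  finally show ?thesis
    using zr by (simp add: field_simps)
qed

text \<open>For a logarithm \<open>g\<close> of a bounded function only the real part is controlled,
  and only from above. Borel-Caratheodory turns this into a bound of the modulus on the half disc,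
  Cauchy's estimate then bounds the second derivative on the quarter disc, and Taylor's formula
  concludes.\<close>

lemma linear_approximation_of_Re_bound:
  assumes holg: "g holomorphic_on ball 0 r"
    and re: "\<And>z. z \<in> ball 0 r \<Longrightarrow> Re (g z - g 0) < A" and z: "cmod z \<le> r / 4" and r: "r > 0"
  shows "cmod (g z - g 0 - deriv g 0 * z) \<le> 96 * A * (cmod z)\<^sup>2 / r\<^sup>2"
proof -
  have A: "A > 0"
    using re[of 0] r by simp
  define f where "f w = g w - g 0" for w
  have holf: "f holomorphic_on ball 0 r"
    unfolding f_def using holg by (intro holomorphic_intros)
  \<comment> \<open>Borel-Caratheodory gives \<open>2 * A\<close> at radius \<open>r / 2\<close>.
    The larger \<open>3 * A\<close> makes the inequality strict, because Cauchy's estimate below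
    asks for values in an open ball.\<close>
  have bound: "cmod (f w) < 3 * A" if "cmod w \<le> r / 2" for w
  proof -
    have "cmod (f w) \<le> 2 * A * cmod w / (r - cmod w)"
      using re that r by (intro Borel_Caratheodory[OF holf]) (auto simp: f_def)
    also have "\<dots> \<le> 2 * A * (r / 2) / (r - r / 2)"
      using A that r by (intro frac_le mult_mono) auto
    also have "\<dots> < 3 * A"
      using A r by simp
    finally show ?thesis .
  qed
  have deriv2: "cmod ((deriv ^^ 2) f w) \<le> 96 * A / r\<^sup>2" if "w \<in> cball 0 (r / 4)" for w
  proof -
    have sub: "cmod u \<le> r / 2" if "u \<in> cball w (r / 4)" for u
      using that \<open>w \<in> cball 0 (r / 4)\<close> norm_triangle_ineq2[of u w]
      by (simp add: dist_norm norm_minus_commute)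
    have ball: "cball w (r / 4) \<subseteq> ball 0 r"
      using sub r by fastforce
    have "cmod ((deriv ^^ 2) f w) \<le> fact 2 * (3 * A) / (r / 4) ^ 2"
    proof (rule Cauchy_higher_deriv_bound)
      show "f holomorphic_on ball w (r / 4)"
        by (rule holomorphic_on_subset[OF holf]) (use ball in auto)
      show "continuous_on (cball w (r / 4)) f"
        by (intro holomorphic_on_imp_continuous_on holomorphic_on_subset[OF holf] ball)
      show "f u \<in> ball 0 (3 * A)" if "u \<in> ball w (r / 4)" for u
        using bound[OF sub, of u] that by simp
    qed (use r in auto)
    then show ?thesis
      by (simp add: power2_eq_square field_simps)
  qed
  \<comment> \<open>This form of the remainder divides by \<open>fact 1\<close>, not by
    \<open>fact 2\<close>, so the factor 96 from Cauchy's estimate is not halved.\<close>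
  have "cmod ((deriv ^^ 0) f z - (\<Sum>i\<le>1. (deriv ^^ i) f 0 * (z - 0) ^ i / fact i))
          \<le> 96 * A / r\<^sup>2 * cmod (z - 0) ^ Suc 1 / fact 1"
  proof (rule complex_Taylor[where S = "cball 0 (r / 4)"])
    fix i :: nat and w :: complex assume "w \<in> cball 0 (r / 4)"
    then have "w \<in> ball 0 r"
      using r by auto
    then show "((deriv ^^ i) f has_field_derivative (deriv ^^ Suc i) f w) (at w within cball 0 (r / 4))"
      using holf by (auto intro!: holomorphic_derivI[OF holomorphic_higher_deriv])
  qed (use deriv2 z r in \<open>auto simp: numeral_2_eq_2\<close>)
  moreover have "deriv f 0 = deriv g 0"
    unfolding f_def using holg r
    by (subst deriv_diff) (auto intro!: holomorphic_on_imp_differentiable_at[OF holg])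
  ultimately show ?thesis
    by (simp add: f_def numeral_2_eq_2)
qed

lemma poly_bound_of_circle_bound:
  fixes Q :: "complex poly"
  assumes deg: "degree Q \<le> m" and circle: "\<And>w. cmod w = 1 \<Longrightarrow> cmod (poly Q w) \<le> M"
  shows "cmod (poly Q z) \<le> M * max 1 (cmod z) ^ m"
proof -
  have M: "M \<ge> 0"
    using order_trans[OF norm_ge_zero circle[of 1]] by simp
  have disc: "cmod (poly R w) \<le> M"
    if "\<And>w. cmod w = 1 \<Longrightarrow> cmod (poly R w) \<le> M" "cmod w \<le> 1" for R :: "complex poly" and w
    by (rule maximum_modulus_frontier[of "poly R" "cball 0 1"])
       (use that in \<open>auto intro!: holomorphic_intros continuous_intros\<close>)
  show ?thesis
  proof (cases "cmod z \<le> 1")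
    case True
    then show ?thesis
      using disc[OF circle, of z] by (simp add: max_def)
  next
    case False
    then have z: "z \<noteq> 0" "cmod z > 1"
      by auto
    have refl_circle: "cmod (poly (reflect_poly Q) w) \<le> M" if "cmod w = 1" for w
    proof -
      have "w \<noteq> 0"
        using that by auto
      then show ?thesis
        using circle[of "inverse w"] that
        by (simp add: poly_reflect_poly_nz norm_mult norm_power norm_inverse)
    qed
    have "poly Q z = z ^ degree Q * poly (reflect_poly Q) (inverse z)"
      using z by (simp add: poly_reflect_poly_nz power_inverse)
    then have "cmod (poly Q z) = cmod z ^ degree Q * cmod (poly (reflect_poly Q) (inverse z))"
      by (simp add: norm_mult norm_power)
    also have "\<dots> \<le> cmod z ^ m * M"
    proof (rule mult_mono)
      show "cmod (poly (reflect_poly Q) (inverse z)) \<le> M"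
        by (rule disc[OF refl_circle]) (use z in \<open>simp_all add: norm_inverse inverse_le_1_iff\<close>)
    qed (use z deg in \<open>simp_all add: power_increasing\<close>)
    finally show ?thesis
      using z by (simp add: max_def mult.commute)
  qed
qed

lemma poly_conj_reciprocal:
  assumes "z \<noteq> 0"
  shows "poly (conj_reciprocal p) z = z ^ degree p * cnj (poly p (1 / cnj z))"
proof -
  have "poly (conj_reciprocal p) z = (\<Sum>k\<le>degree p. cnj (coeff p (degree p - k)) * z ^ k)"
    by (simp add: conj_reciprocal_def poly_sum poly_monom)
  also have "\<dots> = (\<Sum>k\<le>degree p. cnj (coeff p k) * z ^ (degree p - k))"
    by (rule sum.reindex_bij_witness[of _ "\<lambda>k. degree p - k" "\<lambda>k. degree p - k"]) auto
  also have "\<dots> = (\<Sum>k\<le>degree p. z ^ degree p * (cnj (coeff p k) * (1 / z) ^ k))"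
    using assms by (intro sum.cong) (auto simp: power_diff power_one_over field_simps)
  also have "\<dots> = z ^ degree p * cnj (poly p (1 / cnj z))"
    by (simp add: poly_altdef sum_distrib_left)
  finally show ?thesis .
qed

lemma degree_conj_reciprocal_le: "degree (conj_reciprocal p) \<le> degree p"
  unfolding conj_reciprocal_def
proof (rule degree_sum_le)
  show "degree (monom (cnj (coeff p (degree p - k))) k) \<le> degree p" if "k \<in> {..degree p}" for k
    using degree_monom_le[of "cnj (coeff p (degree p - k))" k] that by simp
qed simp

lemma poly_conj_reciprocal_cis:
  "poly (conj_reciprocal p) (cis t) = cis t ^ degree p * cnj (poly p (cis t))"
proof -
  have "1 / cnj (cis t) = cis t"
    by (simp add: cis_cnj field_simps cis_mult)
  then show ?thesis
    by (simp add: poly_conj_reciprocal)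
qed

text \<open>On the circle the product of \<open>p\<close> and its conjugate reciprocal is
  \<open>|p|^2 z^n\<close>, so the polynomial \<open>S\<close> is at most \<open>e\<close> there and
  at most \<open>e * max 1 |z| ^ (2 * n)\<close> everywhere. At a zero of \<open>p\<close> its
  modulus is exactly \<open>|z|^n\<close>, which a small \<open>e\<close> forbids inside the
  annulus.\<close>

lemma nonzero_near_circle:
  fixes p :: "complex poly"
  assumes flat: "\<And>t. \<bar>(cmod (poly p (cis t)))\<^sup>2 - 1\<bar> \<le> e" and e: "e * exp (2 * K) < 1"
    and z: "exp (- K) \<le> cmod z ^ degree p" "cmod z ^ degree p \<le> exp K"
  shows "poly p z \<noteq> 0"
proof
  assume zero: "poly p z = 0"
  define n where "n = degree p"
  define S where "S = p * conj_reciprocal p - monom 1 n"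
  have e0: "e \<ge> 0"
    using flat[of 0] by linarith
  have "degree S \<le> 2 * n"
    unfolding S_def
  proof (rule degree_diff_le)
    show "degree (p * conj_reciprocal p) \<le> 2 * n"
      using degree_mult_le[of p "conj_reciprocal p"] degree_conj_reciprocal_le[of p] by (simp add: n_def)
    show "degree (monom (1 :: complex) n) \<le> 2 * n"
      using degree_monom_le[of "1 :: complex" n] by simp
  qed
  moreover have "cmod (poly S w) \<le> e" if w1: "cmod w = 1" for w
  proof -
    obtain t where w: "w = cis t"
      using rcis_cmod_Arg[of w] w1 by (simp add: rcis_def) metis
    have "poly S w = cis t ^ n * (((cmod (poly p (cis t)))\<^sup>2 - 1 :: real))"
      unfolding of_real_diff complex_norm_square
      by (simp add: S_def w poly_conj_reciprocal_cis poly_monom n_def algebra_simps)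
    then show ?thesis
      using flat[of t] by (simp only: norm_mult norm_power norm_cis norm_of_real) simp
  qed
  ultimately have "cmod (poly S z) \<le> e * max 1 (cmod z) ^ (2 * n)"
    by (rule poly_bound_of_circle_bound)
  moreover have "cmod (poly S z) = cmod z ^ n"
    using zero by (simp add: S_def poly_monom norm_power)
  ultimately have le: "cmod z ^ n \<le> e * max 1 (cmod z) ^ (2 * n)"
    by simp
  have z0: "cmod z ^ n > 0"
    using z(1) exp_gt_zero[of "- K"] by (simp add: n_def del: exp_gt_zero)
  have K: "exp (- K) \<le> exp K"
    using z by linarith
  then have K0: "K \<ge> 0" by simp
  show False
  proof (cases "cmod z \<ge> 1")
    case True
    have "cmod z ^ (2 * n) = cmod z ^ n * cmod z ^ n"
      by (simp add: mult_2 power_add)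
    then have "cmod z ^ n * 1 \<le> cmod z ^ n * (e * cmod z ^ n)"
      using le True by (simp add: max_def mult_ac)
    then have "1 \<le> e * cmod z ^ n"
      using z0 by (subst (asm) mult_le_cancel_left_pos) auto
    also have "\<dots> \<le> e * exp (2 * K)"
      using e0 z(2) K0 by (intro mult_left_mono) (auto simp: n_def intro: order_trans)
    finally show False
      using e by simp
  next
    case False
    then have "exp (- K) \<le> e"
      using le z(1) by (simp add: max_def n_def)
    then have "1 \<le> e * exp K"
      by (simp add: exp_minus field_simps)
    also have "\<dots> \<le> e * exp (2 * K)"
      using e0 K0 by (intro mult_left_mono) auto
    finally show False
      using e by simp
  qed
qed

section \<open>Local exponential behaviour at scale \<open>1 / n\<close>\<close>

text \<open>On the disc of radius \<open>K / n\<close> the function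
  \<open>z \<mapsto> p (e^(i(t + z)))\<close> has no zeros, hence a logarithm, and the linear part
  of that logarithm provides \<open>c\<close>. The order of quantifiers matters: \<open>e\<close>
  depends on \<open>C\<close> and \<open>\<delta>\<close> only, not on the degree.\<close>

lemma exp_local_of_flat:
  fixes C \<delta> :: real
  assumes C: "C > 0" and \<delta>: "\<delta> > 0"
  obtains e where "e > 0"
    "\<And>(p :: complex poly) t. \<lbrakk>degree p \<ge> 1; \<And>s. \<bar>(cmod (poly p (cis s)))\<^sup>2 - 1\<bar> \<le> e\<rbrakk> \<Longrightarrow>
       \<exists>c. \<forall>x::real. \<bar>x\<bar> * degree p \<le> C \<longrightarrow>
         (\<exists>r. cmod r \<le> \<delta> \<and> poly p (cis (t + x)) = poly p (cis t) * exp (c * of_real x + r))"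
proof -
  \<comment> \<open>The bound 2 absorbs the constant \<open>2 * ln 2\<close> in
    \<open>Re_diff\<close>, the bound \<open>4 * C\<close> places \<open>|x| \<le> C / n\<close>
    within a quarter of the radius \<open>K / n\<close>, and the last one makes the final error
    \<open>192 * C^2 / K\<close> at most \<open>\<delta>\<close>.\<close>
  define K where "K = max 2 (max (4 * C) (192 * C\<^sup>2 / \<delta>))"
  have K2: "K \<ge> 2" and K4: "K \<ge> 4 * C" and K\<delta>: "K \<ge> 192 * C\<^sup>2 / \<delta>"
    unfolding K_def by auto
  define e where "e = exp (- (2 * K)) / 2"
  have e: "e > 0" "e * exp (2 * K) < 1"
    by (simp_all add: e_def exp_minus)
  have e_half: "e \<le> 1 / 2"
    using K2 by (simp add: e_def)
  show thesis
  proof (rule that[OF e(1)])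
    fix p :: "complex poly" and t :: real
    assume deg: "degree p \<ge> 1" and flat: "\<And>s. \<bar>(cmod (poly p (cis s)))\<^sup>2 - 1\<bar> \<le> e"
    define n where "n = real (degree p)"
    have n: "n \<ge> 1"
      using deg by (simp add: n_def)
    define r where "r = K / n"
    have r: "r > 0"
      using K2 n by (simp add: r_def)
    define f where "f z = poly p (cis t * exp (\<i> * z))" for z
    have near: "exp (- K) \<le> cmod (cis t * exp (\<i> * z)) ^ degree p"
               "cmod (cis t * exp (\<i> * z)) ^ degree p \<le> exp K" if "z \<in> ball 0 r" for z
    proof -
      have eq: "cmod (cis t * exp (\<i> * z)) ^ degree p = exp (- (n * Im z))"
        by (simp add: norm_mult norm_exp_eq_Re n_def flip: exp_of_nat_mult)
      have "n * \<bar>Im z\<bar> \<le> n * r"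
        using that n abs_Im_le_cmod[of z] by (intro mult_left_mono) auto
      then have "\<bar>n * Im z\<bar> \<le> K"
        using n by (simp add: r_def abs_mult)
      then show "exp (- K) \<le> cmod (cis t * exp (\<i> * z)) ^ degree p"
                "cmod (cis t * exp (\<i> * z)) ^ degree p \<le> exp K"
        unfolding eq by (simp_all add: abs_le_iff)
    qed
    have f_nz: "f z \<noteq> 0" if "z \<in> ball 0 r" for z
      unfolding f_def using near[OF that] by (intro nonzero_near_circle[OF flat e(2)])
    have f_le: "cmod (f z) \<le> 2 * exp K" if "z \<in> ball 0 r" for z
    proof -
      have "cmod (poly p w) \<le> 2" if "cmod w = 1" for w
      proof -
        have "w = cis (Arg w)"
          using rcis_cmod_Arg[of w] that by (simp add: rcis_def)
        then have "(cmod (poly p w))\<^sup>2 \<le> 2\<^sup>2"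
          using flat[of "Arg w"] e_half by simp
        then show ?thesis
          by (rule power2_le_imp_le) simp
      qed
      then have "cmod (f z) \<le> 2 * max 1 (cmod (cis t * exp (\<i> * z))) ^ degree p"
        unfolding f_def by (intro poly_bound_of_circle_bound) auto
      also have "max 1 (cmod (cis t * exp (\<i> * z))) ^ degree p \<le> exp K"
        using near(2)[OF that] K2 by (auto simp: max_def)
      finally show ?thesis
        by simp
    qed
    have f0: "cmod (f 0) \<ge> 1 / 2"
    proof -
      have "(1 / 2)\<^sup>2 \<le> (cmod (f 0))\<^sup>2"
        using flat[of t] e_half by (simp add: f_def power2_eq_square)
      then show ?thesis
        by (rule power2_le_imp_le) simp
    qed
    have holf: "f holomorphic_on ball 0 r"
      unfolding f_def by (intro holomorphic_intros)
    have "contractible (ball (0 :: complex) r)"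
      by (intro convex_imp_contractible) auto
    then obtain g where holg: "g holomorphic_on ball 0 r"
      and fg: "\<And>z. z \<in> ball 0 r \<Longrightarrow> f z = exp (g z)"
      using contractible_imp_holomorphic_log[OF holf _ f_nz] by metis
    have Re_g: "Re (g z) = ln (cmod (f z))" if "z \<in> ball 0 r" for z
      using fg[OF that] by simp
    have Re_diff: "Re (g z - g 0) < 2 * K" if "z \<in> ball 0 r" for z
    proof -
      have "ln (cmod (f z)) \<le> ln (2 * exp K)"
        using f_le[OF that] f_nz[OF that] by (intro ln_mono) auto
      moreover have "ln (cmod (f 0)) \<ge> ln (1 / 2)"
        using f0 by (intro ln_mono) auto
      moreover have "ln (2 :: real) < 1"
        by (rule ln_2_less_1)
      ultimately show ?thesis
        using Re_g[OF that] Re_g[of 0] r K2 by (simp add: ln_mult ln_divide_pos)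
    qed
    have "\<exists>u. cmod u \<le> \<delta> \<and>
            poly p (cis (t + x)) = poly p (cis t) * exp (deriv g 0 * of_real x + u)"
      if x: "\<bar>x\<bar> * n \<le> C" for x :: real
    proof (intro exI conjI)
      let ?z = "complex_of_real x" 
      have xr: "\<bar>x\<bar> \<le> r / 4"
        using x n K4 by (simp add: r_def field_simps)
      then have in_ball: "?z \<in> ball 0 r"
        using r by simp
      \<comment> \<open>The bound \<open>2 * K\<close> on the real part grows linearly in
        \<open>K\<close> while \<open>r^2\<close> grows quadratically, so the error decays like
        \<open>1 / K\<close>.\<close>
      have "cmod (g ?z - g 0 - deriv g 0 * ?z) \<le> 96 * (2 * K) * (cmod ?z)\<^sup>2 / r\<^sup>2"
        by (rule linear_approximation_of_Re_bound[OF holg Re_diff]) (use xr r in auto)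
      also have "\<dots> = 192 * (\<bar>x\<bar> * n)\<^sup>2 / K"
        using K2 n by (simp add: r_def power2_eq_square field_simps)
      also have "\<dots> \<le> 192 * C\<^sup>2 / K"
        using x K2 n by (intro divide_right_mono mult_left_mono power_mono) auto
      also have "\<dots> \<le> \<delta>"
        using K\<delta> K2 \<delta> by (simp add: field_simps)
      finally show "cmod (g ?z - g 0 - deriv g 0 * ?z) \<le> \<delta>" .
      have "poly p (cis (t + x)) = f ?z"
        by (simp add: f_def cis_conv_exp distrib_left exp_add)
      also have "\<dots> = f 0 * exp (deriv g 0 * ?z + (g ?z - g 0 - deriv g 0 * ?z))"
        using fg[OF in_ball] fg[of 0] r by (simp flip: exp_add)
      finally show "poly p (cis (t + x)) =
          poly p (cis t) * exp (deriv g 0 * ?z + (g ?z - g 0 - deriv g 0 * ?z))"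
        by (simp add: f_def)
    qed
    then show "\<exists>c. \<forall>x::real. \<bar>x\<bar> * degree p \<le> C \<longrightarrow>
        (\<exists>u. cmod u \<le> \<delta> \<and> poly p (cis (t + x)) = poly p (cis t) * exp (c * of_real x + u))"
      by (intro exI[of _ "deriv g 0"]) (simp add: n_def)
  qed
qed

text \<open>The same \<open>c\<close> serves the displacements \<open>x\<close> and
  \<open>m * x\<close>, so the main exponents \<open>m * c * x\<close> agree and the two products
  differ only by a factor \<open>exp (m * r - s)\<close>. The gain is that the shift now enters
  through a single factor of \<open>p\<close>, which Parseval can handle.\<close>

lemma power_shift_of_flat:
  fixes C \<eta> :: real and m :: nat
  assumes C: "C > 0" and \<eta>: "\<eta> > 0" and m: "m \<ge> 1"
  obtains e where "e > 0"
    "\<And>(p :: complex poly) t (x :: real). \<lbrakk>degree p \<ge> 1; \<And>s. \<bar>(cmod (poly p (cis s)))\<^sup>2 - 1\<bar> \<le> e;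
       \<bar>x\<bar> * (m * degree p) \<le> C\<rbrakk> \<Longrightarrow>
       cmod (poly p (cis (t + x)) ^ m - poly p (cis t) ^ (m - 1) * poly p (cis (t + m * x))) \<le> \<eta>"
proof -
  \<comment> \<open>The exponent \<open>m * r - s\<close> is at most
    \<open>(m + 1) * \<delta>\<close> in modulus. Being at most 1, it gives an error of at most 4
    times itself after \<open>exp\<close>; the power \<open>2 ^ (m + 2)\<close> pays for this 4 and
    for the \<open>m\<close> factors bounded by 2.\<close>
  define \<delta> where "\<delta> = min 1 (\<eta> / 2 ^ (m + 2)) / (m + 1)"
  have \<delta>: "\<delta> > 0"
    using \<eta> by (simp add: \<delta>_def)
  obtain e where e: "e > 0" and loc: "\<And>(p :: complex poly) t. \<lbrakk>degree p \<ge> 1; \<And>s. \<bar>(cmod (poly p (cis s)))\<^sup>2 - 1\<bar> \<le> e\<rbrakk> \<Longrightarrow>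
       \<exists>c. \<forall>x::real. \<bar>x\<bar> * degree p \<le> C \<longrightarrow>
         (\<exists>r. cmod r \<le> \<delta> \<and> poly p (cis (t + x)) = poly p (cis t) * exp (c * of_real x + r))"
    using exp_local_of_flat[OF C \<delta>] by metis
  show thesis
  proof (rule that[of "min e 1"])
    show "min e 1 > 0"
      using e by simp
    fix p :: "complex poly" and t x :: real
    assume deg: "degree p \<ge> 1" and flat: "\<And>s. \<bar>(cmod (poly p (cis s)))\<^sup>2 - 1\<bar> \<le> min e 1"
      and x: "\<bar>x\<bar> * (m * degree p) \<le> C"
    obtain c where c: "\<And>x::real. \<bar>x\<bar> * degree p \<le> C \<Longrightarrow>
        \<exists>r. cmod r \<le> \<delta> \<and> poly p (cis (t + x)) = poly p (cis t) * exp (c * of_real x + r)"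
      using loc[OF deg, of t] flat by (metis min.boundedE)
    have "\<bar>x\<bar> * degree p \<le> \<bar>x\<bar> * (m * degree p)"
      using mult_right_mono[of 1 "real m" "real (degree p)"] m by (intro mult_left_mono) auto
    then obtain r where r: "cmod r \<le> \<delta>"
      "poly p (cis (t + x)) = poly p (cis t) * exp (c * of_real x + r)"
      using c[of x] x by auto
    obtain s where s: "cmod s \<le> \<delta>"
      "poly p (cis (t + m * x)) = poly p (cis t) * exp (c * of_real (m * x) + s)"
      using c[of "real m * x"] x by (auto simp: abs_mult mult_ac)
    let ?F = "poly p (cis t)"
    have norm_p: "cmod (poly p (cis u)) \<le> 2" for u
    proof (rule power2_le_imp_le)
      show "(cmod (poly p (cis u)))\<^sup>2 \<le> 2\<^sup>2"
        using flat[of u] by (simp add: abs_le_iff)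
    qed simp
    have pm: "?F ^ m = ?F ^ (m - 1) * ?F"
      using m by (cases m) (simp_all add: mult.commute)
    have small: "cmod (of_nat m * r - s) \<le> (m + 1) * \<delta>"
    proof -
      have "cmod (of_nat m * r - s) \<le> m * cmod r + cmod s"
        using norm_triangle_ineq4[of "of_nat m * r" s] by (simp add: norm_mult)
      also have "\<dots> \<le> m * \<delta> + \<delta>"
        using r(1) s(1) by (intro add_mono mult_left_mono) auto
      finally show ?thesis
        by (simp add: algebra_simps)
    qed
    have small': "cmod (of_nat m * r - s) \<le> 1" "cmod (of_nat m * r - s) \<le> \<eta> / 2 ^ (m + 2)"
      using small by (simp_all add: \<delta>_def)
    have "poly p (cis (t + x)) ^ m = ?F ^ m * exp (of_nat m * (c * of_real x + r))"
      by (simp add: r(2) power_mult_distrib exp_of_nat_mult)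
    also have "of_nat m * (c * of_real x + r) = (c * of_real (m * x) + s) + (of_nat m * r - s)"
      by (simp add: algebra_simps)
    also have "?F ^ m * exp \<dots> = ?F ^ (m - 1) * (?F * exp (c * of_real (m * x) + s)) * exp (of_nat m * r - s)"
      unfolding exp_add[of "c * of_real (m * x) + s" "of_nat m * r - s"] pm by (simp only: mult_ac)
    also have "\<dots> = ?F ^ (m - 1) * poly p (cis (t + m * x)) * exp (of_nat m * r - s)"
      by (simp only: s(2))
    finally have "poly p (cis (t + x)) ^ m - ?F ^ (m - 1) * poly p (cis (t + m * x))
        = ?F ^ (m - 1) * poly p (cis (t + m * x)) * (exp (of_nat m * r - s) - 1)"
      by (simp add: algebra_simps)
    then have "cmod (poly p (cis (t + x)) ^ m - ?F ^ (m - 1) * poly p (cis (t + m * x)))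
        = cmod ?F ^ (m - 1) * cmod (poly p (cis (t + m * x))) * cmod (exp (of_nat m * r - s) - 1)"
      by (simp add: norm_mult norm_power)
    also have "\<dots> \<le> 2 ^ (m - 1) * 2 * (4 * (\<eta> / 2 ^ (m + 2)))"
    proof (intro mult_mono power_mono norm_p)
      have "cmod (exp (of_nat m * r - s) - 1) \<le> exp (cmod (of_nat m * r - s)) * cmod (of_nat m * r - s)"
        using Taylor_exp_field[of "of_nat m * r - s" 0] by simp
      also have "\<dots> \<le> exp 1 * cmod (of_nat m * r - s)"
        using small'(1) by (intro mult_right_mono) auto
      also have "\<dots> \<le> 4 * cmod (of_nat m * r - s)"
        using exp_le by (intro mult_right_mono) auto
      finally have "cmod (exp (of_nat m * r - s) - 1) \<le> 4 * cmod (of_nat m * r - s)" .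
      then show "cmod (exp (of_nat m * r - s) - 1) \<le> 4 * (\<eta> / 2 ^ (m + 2))"
        using small'(2) by simp
    qed auto
    also have "\<dots> = \<eta>"
      using m by (cases m) simp_all
    finally show "cmod (poly p (cis (t + x)) ^ m - ?F ^ (m - 1) * poly p (cis (t + m * x))) \<le> \<eta>" .
  qed
qed

section \<open>Moments by van der Corput shifts\<close>

lemma has_integral_cis_int:
  assumes "k \<noteq> 0"
  shows "((\<lambda>t. cis (of_int k * t)) has_integral 0) {0..2 * pi}"
proof -
  have "((\<lambda>t. cis (of_int k * t)) has_integral
      cis (of_int k * (2 * pi)) / (\<i> * of_int k) - cis (of_int k * 0) / (\<i> * of_int k)) {0..2 * pi}"
  proof (rule fundamental_theorem_of_calculus)
    fix t :: real
    have "((\<lambda>t. exp (\<i> * of_int k * t)) has_field_derivative exp (\<i> * of_int k * t) * (\<i> * of_int k)) (at (of_real t))"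
      by (auto intro!: derivative_eq_intros)
    then have "((\<lambda>t::real. exp (\<i> * of_int k * t)) has_vector_derivative exp (\<i> * of_int k * t) * (\<i> * of_int k)) (at t within {0..2 * pi})"
      by (rule has_vector_derivative_real_field)
    from has_vector_derivative_divide[OF this, of "\<i> * of_int k"]
    show "((\<lambda>t. cis (of_int k * t) / (\<i> * of_int k)) has_vector_derivative cis (of_int k * t)) (at t within {0..2 * pi})"
      using assms by (simp add: cis_conv_exp mult_ac)
  qed auto
  moreover have "cis (of_int k * (2 * pi)) = 1"
    using cis_multiple_2pi[of "of_int k"] by (simp add: mult_ac)
  ultimately show ?thesis
    by simp
qed

lemma Parseval_finite:
  fixes d :: "nat \<Rightarrow> complex"
  shows "((\<lambda>t. (cmod (\<Sum>k\<in>A. d k * cis t ^ k))\<^sup>2) has_integral 2 * pi * (\<Sum>k\<in>A. (cmod (d k))\<^sup>2)) {0..2 * pi}"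
proof (cases "finite A")
  case fin: True
  have int: "((\<lambda>t. d k * cnj (d l) * cis (of_int (int k - int l) * t)) has_integral
      (if k = l then 2 * pi * d k * cnj (d l) else 0)) {0..2 * pi}" for k l
  proof (cases "k = l")
    case True
    then show ?thesis
      using has_integral_const_real[of "d k * cnj (d k)" 0 "2 * pi"] by (simp add: scaleR_conv_of_real mult_ac)
  next
    case False
    then show ?thesis
      using has_integral_mult_right[OF has_integral_cis_int[of "int k - int l"], of "d k * cnj (d l)"] by simp
  qed
  have eq: "complex_of_real ((cmod (\<Sum>k\<in>A. d k * cis t ^ k))\<^sup>2)
      = (\<Sum>k\<in>A. \<Sum>l\<in>A. d k * cnj (d l) * cis (of_int (int k - int l) * t))" for t
    unfolding complex_norm_square cnj_sum sum_product
  proof (intro sum.cong refl)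
    fix k l
    have "cis t ^ k * cnj (cis t ^ l) = cis (of_int (int k - int l) * t)"
      by (simp add: Complex.DeMoivre cis_cnj cis_mult left_diff_distrib)
    then show "d k * cis t ^ k * cnj (d l * cis t ^ l) = d k * cnj (d l) * cis (of_int (int k - int l) * t)"
      by (simp add: mult_ac)
  qed
  have "((\<lambda>t. complex_of_real ((cmod (\<Sum>k\<in>A. d k * cis t ^ k))\<^sup>2)) has_integral
      (\<Sum>k\<in>A. \<Sum>l\<in>A. if k = l then 2 * pi * d k * cnj (d l) else 0)) {0..2 * pi}"
    unfolding eq by (intro has_integral_sum fin int)
  also have "(\<Sum>k\<in>A. \<Sum>l\<in>A. if k = l then 2 * pi * d k * cnj (d l) else 0)
      = of_real (2 * pi * (\<Sum>k\<in>A. (cmod (d k))\<^sup>2))"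
    using fin by (simp add: complex_norm_square sum_distrib_left mult_ac flip: of_real_power)
  finally have "((\<lambda>t. complex_of_real ((cmod (\<Sum>k\<in>A. d k * cis t ^ k))\<^sup>2)) has_integral
      of_real (2 * pi * (\<Sum>k\<in>A. (cmod (d k))\<^sup>2))) {0..2 * pi}" .
  from has_integral_Re[OF this] show ?thesis
    by (simp only: Re_complex_of_real)
qed auto

text \<open>The range of \<open>d\<close> excludes multiples of \<open>M\<close>, so this is a full
  geometric sum over an \<open>M\<close>-th root of unity other than 1.\<close>

lemma sum_cis_eq_0:
  fixes d :: int and M :: nat
  assumes "0 < \<bar>d\<bar>" "\<bar>d\<bar> < int M"
  shows "(\<Sum>k<M. cis (2 * pi * of_int d / real M * real k)) = 0"
proof -
  let ?z = "cis (2 * pi * of_int d / real M)"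
  have "M > 0"
    using assms by auto
  have "?z \<noteq> 1"
  proof
    assume "?z = 1"
    then have "cos (2 * pi * of_int d / real M) = 1"
      by (metis Re_complex_of_real cis.sel(1) of_real_1)
    then obtain j :: int where "2 * pi * of_int d / real M = of_int j * 2 * pi"
      by (auto simp: cos_one_2pi_int)
    then have "of_int d = (of_int (j * int M) :: real)"
      using \<open>M > 0\<close> by (simp add: field_simps)
    then have "d = j * int M"
      by (simp only: of_int_eq_iff)
    then have "int M dvd d"
      by simp
    then show False
      using assms zdvd_imp_le[of "int M" "\<bar>d\<bar>"] by simp
  qed
  moreover have "?z ^ M = 1"
    using \<open>M > 0\<close> cis_multiple_2pi[of "of_int d"] by (simp add: Complex.DeMoivre)
  moreover have "(\<Sum>k<M. cis (2 * pi * of_int d / real M * real k)) = (\<Sum>k<M. ?z ^ k)"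
    by (simp add: Complex.DeMoivre mult_ac)
  ultimately show ?thesis
    by (simp add: geometric_sum)
qed

text \<open>Since \<open>N \<le> M\<close>, distinct \<open>j, l < N\<close> differ by less than
  \<open>M\<close>, so all off-diagonal sums vanish. In the application \<open>k\<close> is a
  coefficient index and \<open>j\<close> numbers the shifts.\<close>

lemma discrete_Parseval:
  fixes c :: "nat \<Rightarrow> complex" and M N :: nat
  assumes "N \<le> M"
  shows "(\<Sum>k<M. (cmod (\<Sum>j<N. c j * cis (2 * pi * real j / real M * real k)))\<^sup>2) = M * (\<Sum>j<N. (cmod (c j))\<^sup>2)"
proof -
  have "complex_of_real (\<Sum>k<M. (cmod (\<Sum>j<N. c j * cis (2 * pi * real j / real M * real k)))\<^sup>2)
      = (\<Sum>k<M. \<Sum>j<N. \<Sum>l<N. c j * cnj (c l) * cis (2 * pi * of_int (int j - int l) / real M * real k))"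
    unfolding of_real_sum complex_norm_square cnj_sum sum_product
    by (intro sum.cong refl)
       (simp add: cis_cnj cis_mult left_diff_distrib right_diff_distrib diff_divide_distrib mult_ac)
  also have "\<dots> = (\<Sum>j<N. \<Sum>k<M. \<Sum>l<N. c j * cnj (c l) * cis (2 * pi * of_int (int j - int l) / real M * real k))"
    by (rule sum.swap)
  also have "\<dots> = (\<Sum>j<N. \<Sum>l<N. \<Sum>k<M. c j * cnj (c l) * cis (2 * pi * of_int (int j - int l) / real M * real k))"
    by (intro sum.cong refl sum.swap)
  also have "\<dots> = (\<Sum>j<N. \<Sum>l<N. if j = l then M * (c j * cnj (c l)) else 0)"
  proof (intro sum.cong refl)
    fix j l assume jl: "j \<in> {..<N}" "l \<in> {..<N}"
    show "(\<Sum>k<M. c j * cnj (c l) * cis (2 * pi * of_int (int j - int l) / real M * real k))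
        = (if j = l then M * (c j * cnj (c l)) else 0)"
    proof (cases "j = l")
      case False
      then have "(\<Sum>k<M. cis (2 * pi * of_int (int j - int l) / real M * real k)) = 0"
        using jl assms by (intro sum_cis_eq_0) auto
      then show ?thesis
        using False by (simp only: if_False mult_zero_right flip: sum_distrib_left)
    qed simp
  qed
  also have "\<dots> = of_real (M * (\<Sum>j<N. (cmod (c j))\<^sup>2))"
    by (simp add: complex_norm_square sum_distrib_left flip: of_real_power)
  finally show ?thesis
    by (simp only: of_real_eq_iff)
qed

lemma integral_periodic_shift:
  fixes F :: "real \<Rightarrow> 'a :: euclidean_space"
  assumes cont: "continuous_on UNIV F" and per: "\<And>t. F (t + T) = F t" and h: "0 \<le> h" "h \<le> T"
  shows "integral {0..T} (\<lambda>t. F (t + h)) = integral {0..T} F"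
proof -
  have int: "F integrable_on {a..b}" for a b
    by (intro integrable_continuous_real continuous_on_subset[OF cont]) auto
  have shift: "integral {a..b} (\<lambda>t. F (t + c)) = integral {a + c..b + c} F" for a b c
    using integral_shift_Icc_real[of a b F c] by (simp add: o_def add.commute)
  have "integral {0..T} (\<lambda>t. F (t + h)) = integral {h..T + h} F"
    by (simp add: shift)
  also have "\<dots> = integral {h..T} F + integral {T..T + h} F"
    using h int by (subst Henstock_Kurzweil_Integration.integral_combine) auto
  also have "integral {T..T + h} F = integral {0..h} F"
    using shift[of 0 h T] per by (simp add: add.commute)
  also have "integral {h..T} F + integral {0..h} F = integral {0..T} F"
    using h int by (subst add.commute, subst Henstock_Kurzweil_Integration.integral_combine) auto
  finally show ?thesis .
qed

text \<open>By periodicity the integral is the average of its \<open>N\<close> shifts. Pointwise,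
  \<open>shift\<close> pulls out the common factor \<open>poly p (cis t) ^ (m - 1)\<close> and
  leaves a combination \<open>G\<close> of translates of \<open>p\<close>, whose mean square is
  \<open>N\<close> instead of the trivial order \<open>N^2\<close>. The twist by \<open>b\<close>
  contributes only unimodular phases, so the bound is uniform in \<open>b\<close>.\<close>

lemma van_der_Corput_bound:
  fixes p :: "complex poly" and m N :: nat and b :: int and \<eta> :: real
  assumes deg: "degree p \<ge> 1"
    and coeff: "\<And>k. k \<le> degree p \<Longrightarrow> (cmod (coeff p k))\<^sup>2 = 1 / (real (degree p) + 1)"
    and le2: "\<And>t. cmod (poly p (cis t)) \<le> 2"
    and m: "m \<ge> 1" and N: "N \<ge> 1" "N \<le> degree p + 1"
    and shift: "\<And>t x :: real. \<bar>x\<bar> * (real m * real (degree p)) \<le> 2 * pi * real N \<Longrightarrow>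
       cmod (poly p (cis (t + x)) ^ m - poly p (cis t) ^ (m - 1) * poly p (cis (t + m * x))) \<le> \<eta>"
  shows "cmod (integral {0..2 * pi} (\<lambda>t. poly p (cis t) ^ m * cis (of_int b * t)))
           \<le> 2 * pi * (\<eta> + 2 ^ (m - 1) / sqrt N)"
proof -
  define n where "n = degree p"
  \<comment> \<open>Chosen so that \<open>m * x j\<close> is a multiple of
    \<open>2 * pi / (n + 1)\<close>, the spacing at which translates of \<open>p\<close> are
    orthogonal.\<close>
  define x where "x j = 2 * pi * real j / (real m * (real n + 1))" for j :: nat
  define w where "w t = poly p (cis t) ^ m * cis (of_int b * t)" for t
  define G where "G t = (\<Sum>j<N. cis (of_int b * x j) * poly p (cis (t + m * x j)))" for t
  \<comment> \<open>These are the coefficients of \<open>G\<close> as a polynomial in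
    \<open>cis t\<close>. As all coefficients of \<open>p\<close> have squared modulus
    \<open>1 / (n + 1)\<close>, their square sum is a discrete Parseval sum with
    \<open>M = n + 1\<close>.\<close>
  define d where "d k = coeff p k * (\<Sum>j<N. cis (of_int b * x j) * cis (2 * pi * real j / real (n + 1) * real k))" for k
  let ?I = "integral {0..2 * pi} w"
  have mx: "m * x j = 2 * pi * real j / real (n + 1)" for j
    using m by (simp add: x_def add.commute)
  have contw: "continuous_on A w" for A
    unfolding w_def by (intro continuous_intros continuous_on_cis)
  have per: "w (t + 2 * pi) = w t" for t
  proof -
    have "cis (of_int b * (t + 2 * pi)) = cis (of_int b * t) * cis (2 * pi * of_int b)"
      by (simp add: cis_mult distrib_left mult_ac)
    then show ?thesis
      by (simp add: w_def cis_mult[symmetric])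
  qed
  have x_bound: "0 \<le> x j" "x j \<le> 2 * pi" "\<bar>x j\<bar> * (real m * real n) \<le> 2 * pi * N" if "j < N" for j
  proof -
    show x0: "0 \<le> x j"
      by (simp add: x_def)
    have "2 * pi * real j \<le> 2 * pi * (real m * (real n + 1))"
      using that N m mult_mono[of 1 "real m" "real j" "real n + 1"] by (simp add: n_def)
    moreover have "real m * (real n + 1) > 0"
      using m by simp
    ultimately show "x j \<le> 2 * pi"
      by (simp only: x_def pos_divide_le_eq)
    have "\<bar>x j\<bar> * (real m * real n) = (m * x j) * n"
      using x0 by simp
    also have "\<dots> = 2 * pi * real j * (real n / real (n + 1))"
      by (simp add: mx)
    also have "\<dots> \<le> 2 * pi * real N * 1"
      using that by (intro mult_mono) auto
    finally show "\<bar>x j\<bar> * (real m * real n) \<le> 2 * pi * N"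
      by simp
  qed
  have "N * ?I = (\<Sum>j<N. integral {0..2 * pi} (\<lambda>t. w (t + x j)))"
    using x_bound by (simp add: integral_periodic_shift[OF contw per])
  also have "\<dots> = integral {0..2 * pi} (\<lambda>t. \<Sum>j<N. w (t + x j))"
    by (intro integral_sum[symmetric] integrable_continuous_real continuous_on_compose2[OF contw]
        continuous_intros) auto
  finally have NI: "N * ?I = integral {0..2 * pi} (\<lambda>t. \<Sum>j<N. w (t + x j))" .
  have G: "G t = (\<Sum>k\<le>n. d k * cis t ^ k)" for t
  proof -
    have "G t = (\<Sum>j<N. \<Sum>k\<le>n. cis (of_int b * x j) * (coeff p k * (cis t ^ k * cis (m * x j) ^ k)))"
      by (simp add: G_def poly_altdef n_def sum_distrib_left cis_mult[symmetric] power_mult_distrib)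
    also have "\<dots> = (\<Sum>k\<le>n. \<Sum>j<N. cis (of_int b * x j) * (coeff p k * (cis t ^ k * cis (m * x j) ^ k)))"
      by (rule sum.swap)
    also have "\<dots> = (\<Sum>k\<le>n. d k * cis t ^ k)"
      unfolding d_def mx
      by (intro sum.cong refl) (simp add: Complex.DeMoivre sum_distrib_left sum_distrib_right mult_ac)
    finally show ?thesis .
  qed
  have "(\<Sum>k\<le>n. (cmod (d k))\<^sup>2)
      = (\<Sum>k\<le>n. (cmod (\<Sum>j<N. cis (of_int b * x j) * cis (2 * pi * real j / real (n + 1) * real k)))\<^sup>2 / (n + 1))"
    unfolding d_def norm_mult power_mult_distrib
    using coeff by (intro sum.cong refl) (simp add: n_def)
  also have "\<dots> = (\<Sum>k<n + 1. (cmod (\<Sum>j<N. cis (of_int b * x j) * cis (2 * pi * real j / real (n + 1) * real k)))\<^sup>2) / (n + 1)"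
    by (simp only: sum_divide_distrib Suc_eq_plus1[symmetric] lessThan_Suc_atMost)
  also have "\<dots> = N"
    using N by (subst discrete_Parseval) (simp_all add: n_def)
  finally have int_G: "((\<lambda>t. (cmod (G t))\<^sup>2) has_integral 2 * pi * N) {0..2 * pi}"
    unfolding G using Parseval_finite[of d "{..n}"] by simp
  \<comment> \<open>A pointwise AM-GM bound of \<open>cmod (G t)\<close> takes the place of
    Cauchy-Schwarz. The weight \<open>sqrt N\<close> balances its two halves because the mean of
    \<open>(cmod (G t))^2\<close> is \<open>N\<close>.\<close>
  define B where "B t = N * \<eta> + 2 ^ (m - 1) * (((cmod (G t))\<^sup>2 / sqrt N + sqrt N) / 2)" for t
  have le_B: "cmod (\<Sum>j<N. w (t + x j)) \<le> B t" for t
  proof -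
    have "cmod (\<Sum>j<N. w (t + x j)) = cmod (\<Sum>j<N. cis (of_int b * x j) * poly p (cis (t + x j)) ^ m)"
    proof -
      have "(\<Sum>j<N. w (t + x j)) = cis (of_int b * t) * (\<Sum>j<N. cis (of_int b * x j) * poly p (cis (t + x j)) ^ m)"
        by (simp add: w_def sum_distrib_left distrib_left mult_ac flip: cis_mult)
      then show ?thesis
        by (simp add: norm_mult)
    qed
    also have "(\<Sum>j<N. cis (of_int b * x j) * poly p (cis (t + x j)) ^ m)
      = (\<Sum>j<N. cis (of_int b * x j) * (poly p (cis (t + x j)) ^ m - poly p (cis t) ^ (m - 1) * poly p (cis (t + m * x j))))
        + poly p (cis t) ^ (m - 1) * G t"
      by (simp add: G_def sum_distrib_left algebra_simps flip: sum.distrib)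
    also have "cmod \<dots> \<le> (\<Sum>j<N. \<eta>) + 2 ^ (m - 1) * cmod (G t)"
    proof (intro order_trans[OF norm_triangle_ineq] add_mono sum_norm_le)
      show "cmod (cis (of_int b * x j) * (poly p (cis (t + x j)) ^ m - poly p (cis t) ^ (m - 1) * poly p (cis (t + m * x j)))) \<le> \<eta>"
        if "j \<in> {..<N}" for j
        using shift[of "x j" t] x_bound(3)[of j] that by (simp add: norm_mult n_def)
      show "cmod (poly p (cis t) ^ (m - 1) * G t) \<le> 2 ^ (m - 1) * cmod (G t)"
        unfolding norm_mult norm_power by (intro mult_right_mono power_mono le2) auto
    qed
    also have "\<dots> \<le> B t"
    proof -
      have "0 \<le> (cmod (G t) - sqrt N)\<^sup>2 / sqrt N"
        by simp
      also have "\<dots> = (cmod (G t))\<^sup>2 / sqrt N + sqrt N - 2 * cmod (G t)"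
        using N by (simp add: power2_diff field_simps)
      finally have "cmod (G t) \<le> ((cmod (G t))\<^sup>2 / sqrt N + sqrt N) / 2"
        by simp
      then show ?thesis
        by (simp add: B_def)
    qed
    finally show ?thesis .
  qed
  have "(B has_integral
      N * \<eta> * (2 * pi) + 2 ^ (m - 1) * ((2 * pi * N / sqrt N + sqrt N * (2 * pi)) / 2)) {0..2 * pi}"
    unfolding B_def
    using has_integral_const_real[of "N * \<eta>" 0 "2 * pi"] has_integral_const_real[of "sqrt N" 0 "2 * pi"]
    by (intro has_integral_add has_integral_mult_right has_integral_divide int_G) (simp_all add: mult_ac)
  also have "N * \<eta> * (2 * pi) + 2 ^ (m - 1) * ((2 * pi * N / sqrt N + sqrt N * (2 * pi)) / 2)
      = N * (2 * pi * (\<eta> + 2 ^ (m - 1) / sqrt N))"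
    using N by (simp add: field_simps)
  finally have B: "(B has_integral N * (2 * pi * (\<eta> + 2 ^ (m - 1) / sqrt N))) {0..2 * pi}" .
  have "cmod (N * ?I) \<le> integral {0..2 * pi} B"
    unfolding NI
    by (intro integral_norm_bound_integral has_integral_integrable[OF B] le_B integrable_continuous_real
        continuous_on_compose2[OF contw] continuous_intros) auto
  also have "\<dots> = N * (2 * pi * (\<eta> + 2 ^ (m - 1) / sqrt N))"
    using B by (rule integral_unique)
  finally show ?thesis
    using N by (simp add: norm_mult w_def[abs_def] mult.assoc)
qed

section \<open>Equidistribution on the unit circle\<close>

text \<open>This is Weyl's criterion for equidistribution on the unit circle; negative exponents
  follow by conjugation. Unit modulus is demanded only eventually, because flatness excludes zeros
  on the circle only for large \<open>n\<close>.\<close>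

definition unit_moments_vanish :: "(nat \<Rightarrow> real \<Rightarrow> complex) \<Rightarrow> bool" where
  "unit_moments_vanish v \<longleftrightarrow>
     (\<forall>\<^sub>F n in sequentially. continuous_on {0..2 * pi} (v n) \<and> (\<forall>t\<in>{0..2 * pi}. cmod (v n t) = 1)) \<and>
     (\<forall>k\<ge>1. (\<lambda>n. integral {0..2 * pi} (\<lambda>t. v n t ^ k)) \<longlonglongrightarrow> 0)"

lemma unit_moments_vanishD:
  assumes "unit_moments_vanish v"
  shows "\<forall>\<^sub>F n in sequentially. continuous_on {0..2 * pi} (v n) \<and> (\<forall>t\<in>{0..2 * pi}. cmod (v n t) = 1)"
    and "k \<ge> 1 \<Longrightarrow> (\<lambda>n. integral {0..2 * pi} (\<lambda>t. v n t ^ k)) \<longlonglongrightarrow> 0"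
  using assms by (simp_all add: unit_moments_vanish_def)

text \<open>On the unit circle \<open>cnj z\<close> is the inverse of \<open>z\<close>, so the
  product collapses to a power of \<open>v n t\<close> or of its conjugate.\<close>

lemma mixed_moment_tendsto:
  assumes v: "unit_moments_vanish v"
  shows "(\<lambda>n. integral {0..2 * pi} (\<lambda>t. v n t ^ a * cnj (v n t) ^ b)) \<longlonglongrightarrow> complex_of_real (if a = b then 2 * pi else 0)"
proof -
  have power: "z ^ a * cnj z ^ b = (if b \<le> a then z ^ (a - b) else cnj (z ^ (b - a)))" if "cmod z = 1" for z :: complex
  proof -
    have one: "z * cnj z = 1"
      using that by (simp add: that flip: complex_norm_square)
    show ?thesis
    proof (cases "b \<le> a")
      case True
      then have "z ^ a * cnj z ^ b = z ^ (a - b) * (z * cnj z) ^ b"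
        by (simp add: power_mult_distrib mult.assoc[symmetric] flip: power_add)
      with True show ?thesis
        by (simp add: one)
    next
      case False
      then have "z ^ a * cnj z ^ b = cnj z ^ (b - a) * (z * cnj z) ^ a"
        using power_add[of "cnj z" "b - a" a] by (simp add: power_mult_distrib mult_ac)
      with False show ?thesis
        by (simp add: one)
    qed
  qed
  consider "a = b" | "b < a" | "a < b" by linarith
  then show ?thesis
  proof cases
    case 1
    have "\<forall>\<^sub>F n in sequentially. 2 * pi = integral {0..2 * pi} (\<lambda>t. v n t ^ a * cnj (v n t) ^ b)"
      using unit_moments_vanishD(1)[OF v]
    proof eventually_elim
      case (elim n)
      then have "integral {0..2 * pi} (\<lambda>t. v n t ^ a * cnj (v n t) ^ b) = integral {0..2 * pi} (\<lambda>t. 1)"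
        using power 1 by (intro integral_cong) auto
      then show ?case
        by (simp add: scaleR_conv_of_real)
    qed
    with 1 show ?thesis
      by (simp add: tendsto_eventually eventually_mono)
  next
    case 2
    have "\<forall>\<^sub>F n in sequentially. integral {0..2 * pi} (\<lambda>t. v n t ^ (a - b))
        = integral {0..2 * pi} (\<lambda>t. v n t ^ a * cnj (v n t) ^ b)"
      using unit_moments_vanishD(1)[OF v]
      by eventually_elim (use 2 in \<open>auto intro!: integral_cong simp: power\<close>)
    moreover have "a - b \<ge> 1"
      using 2 by simp
    ultimately have "(\<lambda>n. integral {0..2 * pi} (\<lambda>t. v n t ^ a * cnj (v n t) ^ b)) \<longlonglongrightarrow> 0"
      by (intro Lim_transform_eventually[OF unit_moments_vanishD(2)[OF v]])
    with 2 show ?thesis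
      by simp
  next
    case 3
    have "\<forall>\<^sub>F n in sequentially. cnj (integral {0..2 * pi} (\<lambda>t. v n t ^ (b - a)))
        = integral {0..2 * pi} (\<lambda>t. v n t ^ a * cnj (v n t) ^ b)"
      using unit_moments_vanishD(1)[OF v]
    proof eventually_elim
      case (elim n)
      then show ?case
        using 3 unfolding integral_cnj by (intro integral_cong) (auto simp: power)
    qed
    moreover have "b - a \<ge> 1"
      using 3 by simp
    ultimately have "(\<lambda>n. integral {0..2 * pi} (\<lambda>t. v n t ^ a * cnj (v n t) ^ b)) \<longlonglongrightarrow> cnj 0"
      by (intro Lim_transform_eventually[OF tendsto_cnj[OF unit_moments_vanishD(2)[OF v]]])
    with 3 show ?thesis
      by simp
  qed
qed

text \<open>Binomial expansion of \<open>((z + cnj z) / 2) ^ j\<close> reduces this to mixed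
  moments. The limit is left unevaluated: what matters is that it does not depend on
  \<open>v\<close>.\<close>

lemma Re_power_moment_tendsto:
  assumes v: "unit_moments_vanish v"
  shows "(\<lambda>n. integral {0..2 * pi} (\<lambda>t. Re (v n t) ^ j))
           \<longlonglongrightarrow> Re (\<Sum>i\<le>j. of_nat (j choose i) / 2 ^ j * complex_of_real (if i = j - i then 2 * pi else 0))"
proof -
  have eq: "Re z ^ j = Re (\<Sum>i\<le>j. of_nat (j choose i) / 2 ^ j * (z ^ i * cnj z ^ (j - i)))" for z :: complex
  proof -
    have "complex_of_real (Re z ^ j) = ((z + cnj z) / 2) ^ j"
      by (simp add: complex_add_cnj)
    also have "\<dots> = (\<Sum>i\<le>j. of_nat (j choose i) / 2 ^ j * (z ^ i * cnj z ^ (j - i)))"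
      by (simp add: power_divide binomial_ring sum_divide_distrib mult_ac)
    finally show ?thesis
      by (metis Re_complex_of_real)
  qed
  have "\<forall>\<^sub>F n in sequentially.
      Re (\<Sum>i\<le>j. of_nat (j choose i) / 2 ^ j * integral {0..2 * pi} (\<lambda>t. v n t ^ i * cnj (v n t) ^ (j - i)))
      = integral {0..2 * pi} (\<lambda>t. Re (v n t) ^ j)"
    using unit_moments_vanishD(1)[OF v]
  proof eventually_elim
    case (elim n)
    have int: "(\<lambda>t. v n t ^ i * cnj (v n t) ^ (j - i)) integrable_on {0..2 * pi}" for i
      using elim by (intro integrable_continuous_real continuous_intros) auto
    have "((\<lambda>t. \<Sum>i\<le>j. of_nat (j choose i) / 2 ^ j * (v n t ^ i * cnj (v n t) ^ (j - i))) has_integral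
        (\<Sum>i\<le>j. of_nat (j choose i) / 2 ^ j * integral {0..2 * pi} (\<lambda>t. v n t ^ i * cnj (v n t) ^ (j - i)))) {0..2 * pi}"
      by (intro has_integral_sum has_integral_mult_right integrable_integral int) auto
    from integral_unique[OF has_integral_Re[OF this]] show ?case
      by (simp only: eq)
  qed
  moreover have "(\<lambda>n. Re (\<Sum>i\<le>j. of_nat (j choose i) / 2 ^ j * integral {0..2 * pi} (\<lambda>t. v n t ^ i * cnj (v n t) ^ (j - i))))
      \<longlonglongrightarrow> Re (\<Sum>i\<le>j. of_nat (j choose i) / 2 ^ j * complex_of_real (if i = j - i then 2 * pi else 0))"
    by (intro tendsto_Re tendsto_sum tendsto_mult tendsto_const mixed_moment_tendsto[OF v])
  ultimately show ?thesis
    by (rule Lim_transform_eventually[rotated])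
qed

text \<open>The limit \<open>L\<close> is fixed before \<open>v\<close>, so every such sequence
  shares it. It can then be read off from a reference sequence without computing any moment.\<close>

lemma Re_polynomial_moment_tendsto:
  assumes g: "real_polynomial_function (g :: real \<Rightarrow> real)"
  obtains L where "\<And>v. unit_moments_vanish v \<Longrightarrow> (\<lambda>n. integral {0..2 * pi} (\<lambda>t. g (Re (v n t)))) \<longlonglongrightarrow> L"
proof -
  obtain a d where g: "g = (\<lambda>x. \<Sum>i\<le>d. a i * x ^ i)"
    using g real_polynomial_function_iff_sum by blast
  define c where "c j = Re (\<Sum>i\<le>j. of_nat (j choose i) / 2 ^ j * complex_of_real (if i = j - i then 2 * pi else 0))" for j
  show thesis
  proof (rule that)
    fix v assume v: "unit_moments_vanish v"
    have "\<forall>\<^sub>F n in sequentially. (\<Sum>i\<le>d. a i * integral {0..2 * pi} (\<lambda>t. Re (v n t) ^ i))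
        = integral {0..2 * pi} (\<lambda>t. g (Re (v n t)))"
      using unit_moments_vanishD(1)[OF v]
    proof eventually_elim
      case (elim n)
      then have "(\<lambda>t. a i * Re (v n t) ^ i) integrable_on {0..2 * pi}" for i
        by (intro integrable_continuous_real continuous_intros) auto
      then show ?case
        unfolding g by (subst integral_sum) simp_all
    qed
    moreover have "(\<lambda>n. \<Sum>i\<le>d. a i * integral {0..2 * pi} (\<lambda>t. Re (v n t) ^ i)) \<longlonglongrightarrow> (\<Sum>i\<le>d. a i * c i)"
      unfolding c_def by (intro tendsto_intros Re_power_moment_tendsto[OF v])
    ultimately show "(\<lambda>n. integral {0..2 * pi} (\<lambda>t. g (Re (v n t)))) \<longlonglongrightarrow> (\<Sum>i\<le>d. a i * c i)"
      by (rule Lim_transform_eventually[rotated])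
  qed
qed

text \<open>Weierstrass approximation replaces \<open>\<Phi>\<close> by a polynomial. The fixed
  function \<open>u\<close>, viewed as a constant sequence, has the same polynomial limits as
  \<open>v\<close>, and being constant it attains them.\<close>

lemma Re_moment_tendsto:
  fixes \<Phi> :: "real \<Rightarrow> real"
  assumes v: "unit_moments_vanish v" and u: "unit_moments_vanish (\<lambda>_. u)" and cont: "continuous_on {-1..1} \<Phi>"
  shows "(\<lambda>n. integral {0..2 * pi} (\<lambda>t. \<Phi> (Re (v n t)))) \<longlonglongrightarrow> integral {0..2 * pi} (\<lambda>t. \<Phi> (Re (u t)))"
proof (rule LIMSEQ_I)
  fix r :: real assume r: "r > 0"
  \<comment> \<open>Over an interval of length \<open>2 * pi\<close> the approximation costs
    \<open>r / 4\<close>. It is paid for \<open>v n\<close> and for \<open>u\<close>, and the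
    convergence of the polynomial integrals costs a third \<open>r / 4\<close>.\<close>
  define e where "e = r / (8 * pi)"
  have e: "e > 0"
    using r by (simp add: e_def)
  obtain g where g: "real_polynomial_function g" and approx: "\<And>x. x \<in> {-1..1} \<Longrightarrow> \<bar>\<Phi> x - g x\<bar> < e"
    using Stone_Weierstrass_real_polynomial_function[OF compact_Icc cont e] by metis
  obtain L where L: "\<And>v. unit_moments_vanish v \<Longrightarrow> (\<lambda>n. integral {0..2 * pi} (\<lambda>t. g (Re (v n t)))) \<longlonglongrightarrow> L"
    using Re_polynomial_moment_tendsto[OF g] by metis
  have u_props: "continuous_on {0..2 * pi} u" "\<forall>t\<in>{0..2 * pi}. cmod (u t) = 1"
    using unit_moments_vanishD(1)[OF u] by simp_all
  have Lu: "integral {0..2 * pi} (\<lambda>t. g (Re (u t))) = L"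
    using L[OF u] by (simp add: LIMSEQ_const_iff)
  have close: "\<bar>integral {0..2 * pi} (\<lambda>t. \<Phi> (Re (f t))) - integral {0..2 * pi} (\<lambda>t. g (Re (f t)))\<bar> \<le> r / 4"
    if f: "continuous_on {0..2 * pi} f" "\<forall>t\<in>{0..2 * pi}. cmod (f t) = 1" for f :: "real \<Rightarrow> complex"
  proof -
    have range: "Re (f t) \<in> {-1..1}" if "t \<in> {0..2 * pi}" for t
      using abs_Re_le_cmod[of "f t"] f(2) that by (simp add: abs_le_iff)
    have ints: "(\<lambda>t. h (Re (f t))) integrable_on {0..2 * pi}" if "continuous_on {-1..1} h" for h :: "real \<Rightarrow> real"
      using f(1) range
      by (intro integrable_continuous_real continuous_on_compose2[OF that] continuous_intros) auto
    have "continuous_on {-1..1} g"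
      using g by (intro continuous_on_polymonial_function) (simp add: real_polynomial_function_eq)
    then have "norm (integral {0..2 * pi} (\<lambda>t. \<Phi> (Re (f t)) - g (Re (f t)))) \<le> integral {0..2 * pi} (\<lambda>t. e)"
      using range approx
      by (intro integral_norm_bound_integral integrable_diff ints cont) (auto intro: less_imp_le)
    then show ?thesis
      using ints[OF cont] ints[OF \<open>continuous_on {-1..1} g\<close>]
      by (simp add: Henstock_Kurzweil_Integration.integral_diff e_def)
  qed
  have "\<forall>\<^sub>F n in sequentially. dist (integral {0..2 * pi} (\<lambda>t. g (Re (v n t)))) L < r / 4"
    by (rule tendstoD[OF L[OF v]]) (use r in simp)
  with unit_moments_vanishD(1)[OF v]
  have "\<forall>\<^sub>F n in sequentially.
      norm (integral {0..2 * pi} (\<lambda>t. \<Phi> (Re (v n t))) - integral {0..2 * pi} (\<lambda>t. \<Phi> (Re (u t)))) < r"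
  proof eventually_elim
    case (elim n)
    then show ?case
      using close[of "v n"] close[OF u_props] Lu r unfolding dist_real_def real_norm_def by linarith
  qed
  then show "\<exists>no. \<forall>n\<ge>no.
      norm (integral {0..2 * pi} (\<lambda>t. \<Phi> (Re (v n t))) - integral {0..2 * pi} (\<lambda>t. \<Phi> (Re (u t)))) < r"
    by (simp add: eventually_sequentially)
qed

section \<open>The limiting mean\<close>

text \<open>On \<open>(0, pi)\<close> substitute \<open>x = (1 - cos t) / 2\<close>: the derivative
  \<open>sin t / 2\<close> equals \<open>sqrt (x * (1 - x))\<close>, which produces a Beta
  integrand. The interval from \<open>pi\<close> to \<open>2 * pi\<close> contributes the same
  amount, as cosine is even and periodic.\<close>

lemma integral_half_one_minus_cos_powr:
  fixes q :: real
  assumes q: "q > 0"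
  shows "integral {0..2 * pi} (\<lambda>t. ((1 - cos t) / 2) powr (q / 2)) = 2 * Beta ((q + 1) / 2) (1 / 2)"
proof -
  define h where "h t = ((1 - cos t) / 2) powr (q / 2)" for t :: real
  define f where "f x = x powr ((q + 1) / 2 - 1) * (1 - x) powr (1 / 2 - 1)" for x :: real
  define g where "g t = (1 - cos t) / 2" for t :: real
  have conth: "continuous_on A h" for A
    unfolding h_def using q by (intro continuous_on_powr' continuous_intros) auto
  have inth: "h integrable_on {a..b}" for a b
    by (intro integrable_continuous_real conth)
  have g01: "g t \<in> {0<..<1}" if "t \<in> {0<..<pi}" for t
    using that cos_monotone_0_pi[of 0 t] cos_monotone_0_pi[of t pi] by (simp add: g_def)
  have img: "g ` {0<..<pi} = {0<..<1}"
  proof (intro equalityI subsetI)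
    fix x :: real assume x: "x \<in> {0<..<1}"
    then have "arccos (1 - 2 * x) \<in> {0<..<pi}"
      using arccos_lt_bounded[of "1 - 2 * x"] by simp
    moreover have "x = g (arccos (1 - 2 * x))"
      using x by (simp add: g_def)
    ultimately show "x \<in> g ` {0<..<pi}"
      by blast
  qed (use g01 in blast)
  have "(f has_integral Beta ((q + 1) / 2) (1 / 2)) {0<..<1}"
    unfolding f_def using q
    by (subst has_integral_Icc_iff_Ioo[symmetric], intro has_integral_Beta_real) auto
  then have "f absolutely_integrable_on {0<..<1}" "integral {0<..<1} f = Beta ((q + 1) / 2) (1 / 2)"
    by (auto intro!: nonnegative_absolutely_integrable_1 simp: f_def dest: has_integral_integrable)
  moreover have "((\<lambda>t. \<bar>sin t / 2\<bar> * f (g t)) absolutely_integrable_on {0<..<pi} \<and>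
      integral {0<..<pi} (\<lambda>t. \<bar>sin t / 2\<bar> * f (g t)) = Beta ((q + 1) / 2) (1 / 2))
     \<longleftrightarrow> (f absolutely_integrable_on (g ` {0<..<pi}) \<and> integral (g ` {0<..<pi}) f = Beta ((q + 1) / 2) (1 / 2))"
  proof (rule has_absolute_integral_change_of_variables_1')
    show "inj_on g {0<..<pi}"
      by (rule inj_onI) (auto simp: g_def intro: cos_inj_pi)
    show "(g has_field_derivative sin t / 2) (at t within {0<..<pi})" for t
      unfolding g_def by (auto intro!: derivative_eq_intros)
  qed auto
  ultimately have "integral {0<..<pi} (\<lambda>t. \<bar>sin t / 2\<bar> * f (g t)) = Beta ((q + 1) / 2) (1 / 2)"
    by (simp add: img)
  \<comment> \<open>The open interval is essential: at \<open>t = pi\<close> the left side is 0 but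
    \<open>h\<close> is 1.\<close>
  moreover have "\<bar>sin t / 2\<bar> * f (g t) = h t" if t: "t \<in> {0<..<pi}" for t
  proof -
    let ?x = "g t"
    have x: "?x > 0" "1 - ?x > 0"
      using g01[OF t] by auto
    have sin: "sin t / 2 > 0"
      using t by (simp add: sin_gt_zero)
    have "(sin t / 2)\<^sup>2 = ?x * (1 - ?x)"
      unfolding power_divide sin_squared_eq by (simp add: g_def power2_eq_square field_simps)
    then have "sin t / 2 = sqrt (?x * (1 - ?x))"
      using sin by (metis less_imp_le real_sqrt_unique)
    also have "\<dots> = ?x powr (1 / 2) * (1 - ?x) powr (1 / 2)"
      using x by (simp add: real_sqrt_mult powr_half_sqrt)
    finally have "\<bar>sin t / 2\<bar> * f ?x
        = (?x powr (1 / 2) * ?x powr ((q + 1) / 2 - 1)) * ((1 - ?x) powr (1 / 2) * (1 - ?x) powr (1 / 2 - 1))"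
      using sin by (simp add: f_def)
    also have "\<dots> = h t"
      using x by (simp add: h_def g_def add_divide_distrib flip: powr_add)
    finally show ?thesis .
  qed
  ultimately have "integral {0<..<pi} h = Beta ((q + 1) / 2) (1 / 2)"
    by (metis (no_types, lifting) integral_cong)
  then have half: "integral {0..pi} h = Beta ((q + 1) / 2) (1 / 2)"
    by (simp add: integral_open_interval_real)
  have "integral {pi..2 * pi} h = integral {- pi..0} (h \<circ> (+) (2 * pi))"
    using integral_shift_Icc_real[of "- pi" 0 h "2 * pi"] by simp
  also have "h \<circ> (+) (2 * pi) = (\<lambda>t. h (- t))"
    by (simp add: h_def fun_eq_iff cos_add)
  also have "integral {- pi..0} (\<lambda>t. h (- t)) = integral {0..pi} h"
    using Henstock_Kurzweil_Integration.integral_reflect_real[where a = 0 and b = pi and f = h] by simp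
  finally have "integral {pi..2 * pi} h = integral {0..pi} h" .
  moreover have "integral {0..pi} h + integral {pi..2 * pi} h = integral {0..2 * pi} h"
    using inth by (intro Henstock_Kurzweil_Integration.integral_combine) auto
  ultimately show ?thesis
    using half by (simp add: h_def[abs_def])
qed

lemma mean_two_minus_two_cos_powr:
  fixes q :: real
  assumes q: "q > 0"
  shows "1 / (2 * pi) * integral {0..2 * pi} (\<lambda>t. (2 - 2 * cos t) powr (q / 2))
           = 2 powr q * Gamma ((q + 1) / 2) / (Gamma (q / 2 + 1) * sqrt pi)"
proof -
  have "(2 - 2 * cos t) powr (q / 2) = 2 powr q * ((1 - cos t) / 2) powr (q / 2)" for t :: real
  proof -
    have "2 - 2 * cos t = 2 powr 2 * ((1 - cos t) / 2)"
      by (simp add: field_simps)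
    then have "(2 - 2 * cos t) powr (q / 2) = (2 powr 2) powr (q / 2) * ((1 - cos t) / 2) powr (q / 2)"
      by (simp only: powr_mult)
    then show ?thesis
      by (simp only: powr_powr) simp
  qed
  then have "1 / (2 * pi) * integral {0..2 * pi} (\<lambda>t. (2 - 2 * cos t) powr (q / 2))
      = 1 / (2 * pi) * (2 powr q * (2 * Beta ((q + 1) / 2) (1 / 2)))"
    by (simp add: integral_half_one_minus_cos_powr[OF q])
  also have "\<dots> = 2 powr q * Gamma ((q + 1) / 2) / (Gamma (q / 2 + 1) * sqrt pi)"
  proof -
    have "(q + 1) / 2 + 1 / 2 = q / 2 + 1"
      by (simp add: field_simps)
    moreover have "sqrt pi / pi = 1 / sqrt pi"
      using real_div_sqrt[of pi] by (simp add: field_simps)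
    moreover have "1 / (2 * pi) * (2 powr q * (2 * Beta ((q + 1) / 2) (1 / 2)))
        = 2 powr q * Gamma ((q + 1) / 2) / Gamma ((q + 1) / 2 + 1 / 2) * (sqrt pi / pi)"
      by (simp add: Beta_def Gamma_one_half_real mult_ac)
    ultimately show ?thesis
      by simp
  qed
  finally show ?thesis .
qed

section \<open>Ultraflat sequences\<close>

text \<open>The leading coefficient is nonzero, so the degree is exactly \<open>n\<close>. Hence
  \<open>conj_reciprocal\<close>, which is defined through \<open>degree\<close>, reverses precisely
  the coefficients \<open>0, ..., n\<close>.\<close>

lemma degree_unimodular:
  assumes "P \<in> unimodular_polys n"
  shows "degree P = n" and "k \<le> n \<Longrightarrow> cmod (coeff P k) = 1"
proof -
  obtain a where P: "P = (\<Sum>k\<le>n. monom (a k) k)" and a: "\<And>k. k \<le> n \<Longrightarrow> cmod (a k) = 1"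
    using assms by (auto simp: unimodular_polys_def)
  have coeff: "coeff P k = (if k \<le> n then a k else 0)" for k
    by (simp add: P coeff_sum if_distrib)
  have "a n \<noteq> 0"
    using a[of n] by auto
  then show "degree P = n"
    using coeff by (intro antisym degree_le le_degree) auto
  show "k \<le> n \<Longrightarrow> cmod (coeff P k) = 1"
    using a by (simp add: coeff)
qed

text \<open>First \<open>N\<close> is fixed to make the square-root term small, then the tolerance
  \<open>e\<close> is chosen for shifts up to \<open>2 * pi * N\<close>, and only then is
  \<open>n\<close> taken large. The frequencies \<open>b n\<close> may vary arbitrarily since the
  bound does not depend on them.\<close>

lemma flat_moment_tendsto_0:
  fixes p :: "nat \<Rightarrow> complex poly" and m :: nat and b :: "nat \<Rightarrow> int"
  assumes deg: "\<And>n. n \<ge> 1 \<Longrightarrow> degree (p n) = n"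
    and coeff: "\<And>n k. \<lbrakk>n \<ge> 1; k \<le> n\<rbrakk> \<Longrightarrow> (cmod (coeff (p n) k))\<^sup>2 = 1 / (real n + 1)"
    and flat: "\<And>e. e > 0 \<Longrightarrow> \<forall>\<^sub>F n in sequentially. \<forall>t. \<bar>(cmod (poly (p n) (cis t)))\<^sup>2 - 1\<bar> \<le> e"
    and m: "m \<ge> 1"
  shows "(\<lambda>n. integral {0..2 * pi} (\<lambda>t. poly (p n) (cis t) ^ m * cis (of_int (b n) * t))) \<longlonglongrightarrow> 0"
proof (rule tendstoI)
  fix r :: real assume r: "r > 0"
  have "(\<lambda>N. 2 * pi * (2 ^ (m - 1) / sqrt (real N))) \<longlonglongrightarrow> 0"
    by real_asymp
  then have "\<forall>\<^sub>F N in sequentially. 2 * pi * (2 ^ (m - 1) / sqrt (real N)) < r / 2 \<and> N \<ge> 1"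
    using r by (intro eventually_conj order_tendstoD(2) eventually_ge_at_top) auto
  then obtain N :: nat where N: "2 * pi * (2 ^ (m - 1) / sqrt (real N)) < r / 2" "N \<ge> 1"
    by (auto simp: eventually_sequentially)
  \<comment> \<open>Then \<open>2 * pi * \<eta>\<close> is \<open>r / 2\<close>; the other half is
    covered by the choice of \<open>N\<close>.\<close>
  define \<eta> where "\<eta> = r / (4 * pi)"
  have \<eta>: "\<eta> > 0" and C: "2 * pi * real N > 0"
    using r N by (simp_all add: \<eta>_def)
  obtain e where e: "e > 0" and shift: "\<And>(p :: complex poly) t (x :: real).
      \<lbrakk>degree p \<ge> 1; \<And>s. \<bar>(cmod (poly p (cis s)))\<^sup>2 - 1\<bar> \<le> e; \<bar>x\<bar> * (m * degree p) \<le> 2 * pi * real N\<rbrakk> \<Longrightarrow>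
       cmod (poly p (cis (t + x)) ^ m - poly p (cis t) ^ (m - 1) * poly p (cis (t + m * x))) \<le> \<eta>"
    using power_shift_of_flat[OF C \<eta> m] by metis
  show "\<forall>\<^sub>F n in sequentially.
      dist (integral {0..2 * pi} (\<lambda>t. poly (p n) (cis t) ^ m * cis (of_int (b n) * t))) 0 < r"
    using flat[OF e] flat[OF zero_less_one] eventually_ge_at_top[of N]
  proof eventually_elim
    case (elim n)
    have n: "n \<ge> 1" and dn: "degree (p n) = n"
      using elim(3) N(2) deg[of n] by auto
    have le2: "cmod (poly (p n) (cis t)) \<le> 2" for t
    proof (rule power2_le_imp_le)
      show "(cmod (poly (p n) (cis t)))\<^sup>2 \<le> 2\<^sup>2"
        using elim(2)[rule_format, of t] by (simp add: abs_le_iff)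
    qed simp
    have "cmod (integral {0..2 * pi} (\<lambda>t. poly (p n) (cis t) ^ m * cis (of_int (b n) * t)))
        \<le> 2 * pi * (\<eta> + 2 ^ (m - 1) / sqrt N)"
    proof (rule van_der_Corput_bound[OF _ _ le2 m N(2)])
      show "cmod (poly (p n) (cis (t + x)) ^ m - poly (p n) (cis t) ^ (m - 1) * poly (p n) (cis (t + m * x))) \<le> \<eta>"
        if "\<bar>x\<bar> * (real m * real (degree (p n))) \<le> 2 * pi * real N" for t x :: real
        using elim(1) that n dn by (intro shift) simp_all
    qed (use n dn elim(3) coeff in simp_all)
    also have "\<dots> < r"
      using N(1) by (simp add: distrib_left \<eta>_def)
    finally show ?case
      by simp
  qed
qed

text \<open>With \<open>z\<close> the value of \<open>p\<close> and \<open>s = cis (n * t)\<close>,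
  \<open>n\<close> the degree, the conjugate reciprocal takes the value \<open>s * cnj z\<close>.
  This has the same modulus as \<open>z\<close>, and the cross term in the expanded square is the
  real part of \<open>z^2 * cnj s\<close>.\<close>

lemma cmod_diff_conj_reciprocal:
  assumes "poly p (cis t) \<noteq> 0"
  shows "(cmod (poly (p - conj_reciprocal p) (cis t)))\<^sup>2
    = (cmod (poly p (cis t)))\<^sup>2 * (2 - 2 * Re ((poly p (cis t))\<^sup>2 * cis (- (real (degree p) * t)) / of_real ((cmod (poly p (cis t)))\<^sup>2)))"
proof -
  define z where "z = poly p (cis t)"
  define s where "s = cis (real (degree p) * t)"
  have s: "cmod s = 1" "cis (- (real (degree p) * t)) = cnj s"
    by (simp_all add: s_def cis_cnj)
  have z: "cmod z \<noteq> 0"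
    using assms by (simp add: z_def)
  have "(cmod (z - s * cnj z))\<^sup>2 = (cmod z)\<^sup>2 + (cmod (s * cnj z))\<^sup>2 - 2 * Re (z * cnj (s * cnj z))"
    unfolding cmod_power2 by (simp add: power2_eq_square algebra_simps)
  also have "z * cnj (s * cnj z) = z\<^sup>2 * cnj s"
    by (simp add: power2_eq_square mult_ac)
  also have "cmod (s * cnj z) = cmod z"
    by (simp add: norm_mult s)
  also have "(cmod z)\<^sup>2 + (cmod z)\<^sup>2 - 2 * Re (z\<^sup>2 * cnj s)
      = (cmod z)\<^sup>2 * (2 - 2 * Re (z\<^sup>2 * cnj s / of_real ((cmod z)\<^sup>2)))"
    using z unfolding Re_divide_of_real by (simp add: field_simps)
  finally show ?thesis
    using s by (simp add: poly_conj_reciprocal_cis Complex.DeMoivre z_def s_def)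
qed

text \<open>This is the reference sequence for \<open>Re_moment_tendsto\<close>; its real part is
  \<open>cos t\<close>, which leads to the Beta integral.\<close>

lemma unit_moments_vanish_cis: "unit_moments_vanish (\<lambda>_. cis)"
proof -
  have "integral {0..2 * pi} (\<lambda>t. cis t ^ k) = 0" if "k \<ge> 1" for k
    using integral_unique[OF has_integral_cis_int[of "int k"]] that by (simp add: Complex.DeMoivre)
  moreover have "continuous_on {0..2 * pi} cis"
    unfolding cis_conv_exp by (intro continuous_intros)
  ultimately show ?thesis
    by (simp add: unit_moments_vanish_def)
qed

text \<open>Multiplying the \<open>k\<close>-th power by \<open>|p|^(2 * k)\<close>, which tends to
  1 uniformly, clears the denominator. What remains is a moment of \<open>p\<close> with exponent
  \<open>2 * k\<close> and twist \<open>- k * n\<close>.\<close>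

lemma unit_moments_vanish_flat:
  fixes p :: "nat \<Rightarrow> complex poly"
  assumes deg: "\<And>n. n \<ge> 1 \<Longrightarrow> degree (p n) = n"
    and coeff: "\<And>n k. \<lbrakk>n \<ge> 1; k \<le> n\<rbrakk> \<Longrightarrow> (cmod (coeff (p n) k))\<^sup>2 = 1 / (real n + 1)"
    and flat: "\<And>e. e > 0 \<Longrightarrow> \<forall>\<^sub>F n in sequentially. \<forall>t. \<bar>(cmod (poly (p n) (cis t)))\<^sup>2 - 1\<bar> \<le> e"
  shows "unit_moments_vanish
    (\<lambda>n t. (poly (p n) (cis t))\<^sup>2 * cis (- (real n * t)) / of_real ((cmod (poly (p n) (cis t)))\<^sup>2))"
    (is "unit_moments_vanish ?v")
proof -
  have nz: "\<forall>\<^sub>F n in sequentially. \<forall>t. poly (p n) (cis t) \<noteq> 0"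
  proof -
    have "\<forall>\<^sub>F n in sequentially. \<forall>t. \<bar>(cmod (poly (p n) (cis t)))\<^sup>2 - 1\<bar> \<le> 1 / 2"
      by (rule flat) simp
    then show ?thesis
    proof eventually_elim
      case (elim n)
      show ?case
      proof
        fix t
        show "poly (p n) (cis t) \<noteq> 0"
          using elim[rule_format, of t] by auto
      qed
    qed
  qed
  have good: "\<forall>\<^sub>F n in sequentially. continuous_on {0..2 * pi} (?v n) \<and> (\<forall>t. cmod (?v n t) = 1)"
    using nz
  proof eventually_elim
    case (elim n)
    then show ?case
      by (intro conjI allI continuous_intros continuous_on_cis)
         (auto simp: norm_divide norm_mult norm_power)
  qed
  have "(\<lambda>n. integral {0..2 * pi} (\<lambda>t. ?v n t ^ k)) \<longlonglongrightarrow> 0" if k: "k \<ge> 1" for k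
  proof -
    define w where "w n t = poly (p n) (cis t) ^ (2 * k) * cis (of_int (- int (k * n)) * t)" for n t
    have w0: "(\<lambda>n. integral {0..2 * pi} (w n)) \<longlonglongrightarrow> 0"
      unfolding w_def by (rule flat_moment_tendsto_0[OF deg coeff flat]) (use k in auto)
    have wv: "w n t = of_real (((cmod (poly (p n) (cis t)))\<^sup>2) ^ k) * ?v n t ^ k"
      if "poly (p n) (cis t) \<noteq> 0" for n t
    proof -
      have "cis (- (real n * t)) ^ k = cis (of_int (- int (k * n)) * t)"
        by (simp add: Complex.DeMoivre mult_ac)
      then show ?thesis
        using that by (simp add: w_def power_divide power_mult_distrib power_mult flip: of_real_power)
    qed
    have "(\<lambda>n. integral {0..2 * pi} (\<lambda>t. ?v n t ^ k) - integral {0..2 * pi} (w n)) \<longlonglongrightarrow> 0"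
    proof (rule tendstoI)
      fix r :: real assume r: "r > 0"
      have "((\<lambda>y :: real. y ^ k) \<longlongrightarrow> 1 ^ k) (at 1)"
        by (intro tendsto_intros)
      then obtain d where d: "d > 0" "\<And>y :: real. \<lbrakk>y \<noteq> 1; \<bar>y - 1\<bar> < d\<rbrakk> \<Longrightarrow> \<bar>y ^ k - 1\<bar> < r / (4 * pi)"
        using r LIM_D[of "\<lambda>y :: real. y ^ k" 1 1 "r / (4 * pi)"] by auto
      have d': "\<bar>y ^ k - 1\<bar> \<le> r / (4 * pi)" if "\<bar>y - 1\<bar> \<le> d / 2" for y :: real
        using d(2)[of y] that d(1) r by (cases "y = 1") (auto intro: less_imp_le)
      have "\<forall>\<^sub>F n in sequentially. \<forall>t. \<bar>(cmod (poly (p n) (cis t)))\<^sup>2 - 1\<bar> \<le> d / 2"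
        using d(1) by (intro flat) simp
      with good nz show "\<forall>\<^sub>F n in sequentially.
          dist (integral {0..2 * pi} (\<lambda>t. ?v n t ^ k) - integral {0..2 * pi} (w n)) 0 < r"
      proof eventually_elim
        case (elim n)
        have intv: "(\<lambda>t. ?v n t ^ k) integrable_on {0..2 * pi}"
          by (intro integrable_continuous_real continuous_on_power conjunct1[OF elim(1)])
        have intw: "w n integrable_on {0..2 * pi}"
          unfolding w_def by (intro integrable_continuous_real continuous_intros continuous_on_cis)
        have "norm (integral {0..2 * pi} (\<lambda>t. ?v n t ^ k - w n t)) \<le> integral {0..2 * pi} (\<lambda>t. r / (4 * pi))"
        proof (intro integral_norm_bound_integral integrable_diff integrable_const_ivl intv intw)
          fix t
          let ?y = "(cmod (poly (p n) (cis t)))\<^sup>2"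
          have "?v n t ^ k - w n t = of_real (1 - ?y ^ k) * ?v n t ^ k"
            using wv[of n t] elim(2) by (simp add: algebra_simps)
          then have "cmod (?v n t ^ k - w n t) = \<bar>1 - ?y ^ k\<bar>"
            using elim(1) by (simp only: norm_mult norm_power norm_of_real) simp
          then show "cmod (?v n t ^ k - w n t) \<le> r / (4 * pi)"
            using d'[of ?y] elim(3) by (simp add: abs_minus_commute)
        qed
        also have "\<dots> < r"
          using r by simp
        finally show ?case
          using intv intw by (simp add: Henstock_Kurzweil_Integration.integral_diff)
      qed
    qed
    from tendsto_add[OF this w0] show ?thesis
      by simp
  qed
  then show ?thesis
    unfolding unit_moments_vanish_def using good by (auto elim: eventually_mono)
qed

theorem theorem2p1:
  fixes P :: "nat \<Rightarrow> complex poly" and q :: real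
  assumes "ultraflat P" and "q > 0"
  shows "(\<lambda>n. 1 / (2 * pi) *
            integral {0..2 * pi} (\<lambda>t. cmod (poly (P n - conj_reciprocal (P n)) (cis t)) powr q))
         \<sim>[at_top]
         (\<lambda>n. 2 powr q * Gamma ((q + 1) / 2) / (Gamma (q / 2 + 1) * sqrt pi) * real n powr (q / 2))"
proof -
  obtain \<epsilon> :: "nat \<Rightarrow> real" where uni: "\<And>n. n \<ge> 1 \<Longrightarrow> P n \<in> unimodular_polys n"
    and \<epsilon>: "\<epsilon> \<longlonglongrightarrow> 0"
    and lower: "\<And>n t. n \<ge> 1 \<Longrightarrow> (1 - \<epsilon> n) * sqrt (real n + 1) \<le> cmod (poly (P n) (cis t))"
    and upper: "\<And>n t. n \<ge> 1 \<Longrightarrow> cmod (poly (P n) (cis t)) \<le> (1 + \<epsilon> n) * sqrt (real n + 1)"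
    using assms(1) unfolding ultraflat_def by blast
  define p where "p n = smult (of_real (1 / sqrt (real n + 1))) (P n)" for n
  have P: "cmod (poly (P n) (cis t)) = sqrt (real n + 1) * cmod (poly (p n) (cis t))" for n t
    by (simp add: p_def norm_mult norm_divide)
  have deg: "degree (p n) = n" if "n \<ge> 1" for n
    using degree_unimodular(1)[OF uni[OF that]] by (simp add: p_def)
  have coeff: "(cmod (coeff (p n) k))\<^sup>2 = 1 / (real n + 1)" if "n \<ge> 1" "k \<le> n" for n k
    using degree_unimodular(2)[OF uni[OF that(1)] that(2)] by (simp add: p_def norm_mult norm_divide power_divide)
  have flat: "\<forall>\<^sub>F n in sequentially. \<forall>t. \<bar>(cmod (poly (p n) (cis t)))\<^sup>2 - 1\<bar> \<le> e" if e: "e > 0" for e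
  proof -
    have "\<forall>\<^sub>F n in sequentially. \<epsilon> n < min 1 (e / 3)"
      using e by (intro order_tendstoD(2)[OF \<epsilon>]) simp
    then show ?thesis
      using eventually_ge_at_top[of 1]
    proof eventually_elim
      case (elim n)
      show ?case
      proof
        fix t
        let ?y = "cmod (poly (p n) (cis t))"
        have s: "sqrt (real n + 1) > 0"
          by simp
        have "sqrt (real n + 1) * (1 - \<epsilon> n) \<le> sqrt (real n + 1) * ?y"
             "sqrt (real n + 1) * ?y \<le> sqrt (real n + 1) * (1 + \<epsilon> n)"
          using lower[of n t] upper[of n t] elim(2) by (simp_all only: P mult.commute)
        then have "1 - \<epsilon> n \<le> ?y" "?y \<le> 1 + \<epsilon> n"
          using s by (simp_all only: mult_le_cancel_left_pos)
        then have "\<bar>?y - 1\<bar> \<le> \<epsilon> n" "\<bar>?y + 1\<bar> \<le> 3"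
          using elim(1) by auto
        then have "\<bar>?y - 1\<bar> * \<bar>?y + 1\<bar> \<le> \<epsilon> n * 3"
          by (intro mult_mono) auto
        moreover have "?y\<^sup>2 - 1 = (?y - 1) * (?y + 1)"
          by (simp add: power2_eq_square algebra_simps)
        ultimately show "\<bar>?y\<^sup>2 - 1\<bar> \<le> e"
          using elim(1) by (simp add: abs_mult)
      qed
    qed
  qed
  define v where "v n t = (poly (p n) (cis t))\<^sup>2 * cis (- (real n * t)) / of_real ((cmod (poly (p n) (cis t)))\<^sup>2)" for n t
  have v: "unit_moments_vanish v"
    unfolding v_def by (rule unit_moments_vanish_flat[OF deg coeff flat])
  \<comment> \<open>Divided by \<open>(n + 1) powr (q / 2)\<close>, the integrand becomes
    \<open>|p|^q * \<Phi> (Re (v n t))\<close>. The positive exponent keeps \<open>\<Phi>\<close>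
    continuous at \<open>x = 1\<close>, where the base vanishes.\<close>
  define \<Phi> where "\<Phi> x = (2 - 2 * x) powr (q / 2)" for x :: real
  have cont\<Phi>: "continuous_on {-1..1} \<Phi>"
    unfolding \<Phi>_def using assms(2) by (intro continuous_on_powr' continuous_intros) auto
  define L where "L = 2 powr q * Gamma ((q + 1) / 2) / (Gamma (q / 2 + 1) * sqrt pi)"
  have L0: "L > 0"
    unfolding L_def using assms(2) by (intro divide_pos_pos mult_pos_pos Gamma_real_pos) auto
  define I where "I n = integral {0..2 * pi} (\<lambda>t. cmod (poly (P n - conj_reciprocal (P n)) (cis t)) powr q)" for n
  define J where "J n = integral {0..2 * pi} (\<lambda>t. \<Phi> (Re (v n t)))" for n
  have J: "J \<longlonglongrightarrow> 2 * pi * L"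
  proof -
    have "J \<longlonglongrightarrow> integral {0..2 * pi} (\<lambda>t. \<Phi> (Re (cis t)))"
      unfolding J_def by (rule Re_moment_tendsto[OF v unit_moments_vanish_cis cont\<Phi>])
    moreover have "integral {0..2 * pi} (\<lambda>t. \<Phi> (Re (cis t))) = 2 * pi * L"
      using mean_two_minus_two_cos_powr[OF assms(2)] by (simp add: \<Phi>_def L_def field_simps)
    ultimately show ?thesis
      by simp
  qed
  \<comment> \<open>Here \<open>J\<close> differs from the normalized integral only by the factor
    \<open>|p|^q\<close>, which flatness makes uniformly close to 1.\<close>
  have diff: "(\<lambda>n. I n / (real n + 1) powr (q / 2) - J n) \<longlonglongrightarrow> 0"
  proof (rule tendstoI)
    fix r :: real assume r: "r > 0"
    \<comment> \<open>An upper bound for \<open>\<Phi>\<close>, since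
      \<open>2 - 2 * x \<le> 4\<close> on \<open>{-1..1}\<close>.\<close>
    define B where "B = 4 powr (q / 2)"
    have B: "B > 0"
      by (simp add: B_def)
    have "((\<lambda>y :: real. y powr (q / 2)) \<longlongrightarrow> 1 powr (q / 2)) (at 1)"
      by (intro tendsto_intros) auto
    then obtain d where d: "d > 0"
        "\<And>y :: real. \<lbrakk>y \<noteq> 1; \<bar>y - 1\<bar> < d\<rbrakk> \<Longrightarrow> \<bar>y powr (q / 2) - 1\<bar> < r / (4 * pi * B)"
      using r B LIM_D[of "\<lambda>y :: real. y powr (q / 2)" 1 1 "r / (4 * pi * B)"] by auto
    have d': "\<bar>y powr (q / 2) - 1\<bar> \<le> r / (4 * pi * B)" if "\<bar>y - 1\<bar> \<le> d / 2" for y :: real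
      using d(2)[of y] that d(1) r B by (cases "y = 1") (auto intro: less_imp_le)
    \<comment> \<open>The tolerance \<open>1 / 2\<close> keeps the polynomial away from 0 on the
      circle, and \<open>d / 2\<close> feeds \<open>d'\<close>.\<close>
    have "\<forall>\<^sub>F n in sequentially. \<forall>t. \<bar>(cmod (poly (p n) (cis t)))\<^sup>2 - 1\<bar> \<le> min (1 / 2) (d / 2)"
      using d(1) by (intro flat) simp
    then show "\<forall>\<^sub>F n in sequentially. dist (I n / (real n + 1) powr (q / 2) - J n) 0 < r"
      using unit_moments_vanishD(1)[OF v] eventually_ge_at_top[of 1]
    proof eventually_elim
      case (elim n)
      let ?c = "(real n + 1) powr (q / 2)"
      let ?f = "\<lambda>t. cmod (poly (P n - conj_reciprocal (P n)) (cis t)) powr q"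
      have nz: "poly (P n) (cis t) \<noteq> 0" for t
        using P[of n t] elim(1)[rule_format, of t] by auto
      \<comment> \<open>The positive normalizing factor cancels, so \<open>v\<close> is the same
        function for \<open>P n\<close> as for \<open>p n\<close>.\<close>
      have vP: "v n t = (poly (P n) (cis t))\<^sup>2 * cis (- (real n * t)) / of_real ((cmod (poly (P n) (cis t)))\<^sup>2)" for t
      proof -
        define k where "k = 1 / sqrt (real n + 1)"
        have k: "k > 0"
          by (simp add: k_def)
        have "poly (p n) (cis t) = of_real k * poly (P n) (cis t)"
          by (simp add: p_def k_def)
        then show ?thesis
          using k by (simp add: v_def norm_mult power_mult_distrib)
      qed
      have range: "Re (v n t) \<in> {-1..1}" if "t \<in> {0..2 * pi}" for t
        using abs_Re_le_cmod[of "v n t"] elim(2) that by (simp add: abs_le_iff)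
      have f: "?f t / ?c = ((cmod (poly (p n) (cis t)))\<^sup>2) powr (q / 2) * \<Phi> (Re (v n t))" for t
      proof -
        let ?D = "cmod (poly (P n - conj_reciprocal (P n)) (cis t))"
        have "?D\<^sup>2 = (cmod (poly (P n) (cis t)))\<^sup>2 * (2 - 2 * Re (v n t))"
          using cmod_diff_conj_reciprocal[OF nz[of t]] degree_unimodular(1)[OF uni[OF elim(3)]]
          unfolding vP by simp
        also have "\<dots> = (real n + 1) * ((cmod (poly (p n) (cis t)))\<^sup>2 * (2 - 2 * Re (v n t)))"
          by (simp add: P power_mult_distrib)
        finally have "(?D\<^sup>2) powr (q / 2) = ?c * (((cmod (poly (p n) (cis t)))\<^sup>2) powr (q / 2) * \<Phi> (Re (v n t)))"
          by (simp only: powr_mult \<Phi>_def)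
        moreover have "(?D\<^sup>2) powr (q / 2) = ?D powr q"
          by (simp add: powr_powr flip: powr_numeral)
        moreover have "?c > 0"
          by simp
        ultimately show ?thesis
          by (simp only: nonzero_divide_eq_eq[OF less_imp_neq[symmetric]] mult.commute)
      qed
      have int_f: "(\<lambda>t. ?f t / ?c) integrable_on {0..2 * pi}"
        unfolding cis_conv_exp using assms(2)
        by (intro integrable_continuous_real continuous_intros continuous_on_powr') auto
      have int_\<Phi>: "(\<lambda>t. \<Phi> (Re (v n t))) integrable_on {0..2 * pi}"
        using elim(2) range
        by (intro integrable_continuous_real continuous_on_compose2[OF cont\<Phi>] continuous_intros) auto
      have "norm (integral {0..2 * pi} (\<lambda>t. ?f t / ?c - \<Phi> (Re (v n t)))) \<le> integral {0..2 * pi} (\<lambda>t. r / (4 * pi * B) * B)"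
      proof (intro integral_norm_bound_integral integrable_diff integrable_const_ivl int_f int_\<Phi>)
        fix t assume t: "t \<in> {0..2 * pi}"
        let ?y = "(cmod (poly (p n) (cis t)))\<^sup>2"
        have "?f t / ?c - \<Phi> (Re (v n t)) = (?y powr (q / 2) - 1) * \<Phi> (Re (v n t))"
          unfolding f by (simp add: algebra_simps)
        moreover have "0 \<le> \<Phi> (Re (v n t))"
          by (simp add: \<Phi>_def)
        moreover have "\<Phi> (Re (v n t)) \<le> B"
          unfolding \<Phi>_def B_def by (rule powr_mono2) (use range[OF t] assms(2) in auto)
        moreover have "\<bar>?y powr (q / 2) - 1\<bar> \<le> r / (4 * pi * B)"
          using elim(1) by (intro d') auto
        ultimately show "norm (?f t / ?c - \<Phi> (Re (v n t))) \<le> r / (4 * pi * B) * B"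
          using r B by (simp only: real_norm_def abs_mult) (intro mult_mono, auto)
      qed
      also have "\<dots> < r"
        using r B by simp
      also have "integral {0..2 * pi} (\<lambda>t. ?f t / ?c - \<Phi> (Re (v n t))) = I n / ?c - J n"
        using int_f int_\<Phi> by (simp add: Henstock_Kurzweil_Integration.integral_diff I_def J_def)
      finally show ?case
        by simp
    qed
  qed
  have "(\<lambda>n. I n / (real n + 1) powr (q / 2)) \<longlonglongrightarrow> 2 * pi * L"
    using tendsto_add[OF diff J] by simp
  \<comment> \<open>The normalization gave powers of \<open>n + 1\<close>; this passes to the powers
    of \<open>n\<close> in the claim.\<close>
  moreover have "(\<lambda>n. (real n + 1) powr (q / 2) / real n powr (q / 2)) \<longlonglongrightarrow> 1"
    using assms(2) by real_asymp
  ultimately have "(\<lambda>n. (I n / (real n + 1) powr (q / 2)) * ((real n + 1) powr (q / 2) / real n powr (q / 2)) / (2 * pi * L))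
      \<longlonglongrightarrow> 2 * pi * L * 1 / (2 * pi * L)"
    using L0 by (intro tendsto_intros) auto
  then have "(\<lambda>n. (1 / (2 * pi) * I n) / (L * real n powr (q / 2))) \<longlonglongrightarrow> 1"
    using L0 by (simp add: mult_ac)
  then have "(\<lambda>n. 1 / (2 * pi) * I n) \<sim>[at_top] (\<lambda>n. L * real n powr (q / 2))"
    by (rule asymp_equivI')
  then show ?thesis
    unfolding I_def L_def .
qed

end
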